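(* Let $p$ be a prime number and let $\beta\in\mathbb{Q}_p$ be a quadratic number, i.e. $\beta$ is algebraic of degree $2$ over $\mathbb{Q}$. Let $f(X)\in\mathbb{Z}[X]$ be an irreducible polynomial with $f(\beta)=0$. Then, for every real number $\alpha$ with $f(\alpha)\neq 0$, the pair $(\alpha,\beta)$ satisfies $$\inf_{\substack{q,r\in\mathbb{Z}\\ qr\neq 0}} \max\{|q|,|r|\}\,|q\alpha-r|\,|q\beta-r|_p=0.$$ More precisely, $$\liminf_{\max\{|Q|,|R|\}\to+\infty} \max\{|Q|,|R|\}\,\log\max\{|Q|,|R|\}\,|Q\alpha-R|\,|Q\beta-R|_p<+\infty,$$ where the $\liminf$ is taken over pairs of integers $(Q,R)$.
   Context: $\mathbb{Q}_p$ denotes the field of $p$-adic numbers, with the $p$-adic absolute value $|\cdot|_p$ normalized by $|p|_p=1/p$; $|\cdot|$ denotes the usual absolute value on $\mathbb{R}$. *)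

theory Defs
  imports
    Complex_Main
    "HOL-Library.Extended_Real"
    "HOL-Library.Liminf_Limsup"
    "HOL-Computational_Algebra.Computational_Algebra"
    "HOL-Algebra.QuotRing"
begin

section \<open>The \<open>p\<close>-adic absolute value on the rationals\<close>

definition rat_padic_abs :: "nat \<Rightarrow> rat \<Rightarrow> real" where
  "rat_padic_abs p x =
     (if x = 0 then 0
      else real p powi (int (multiplicity (int p) (snd (quotient_of x)))
                        - int (multiplicity (int p) (fst (quotient_of x)))))"

lemma rat_padic_abs_0 [simp]: "rat_padic_abs p 0 = 0"
  by (simp add: rat_padic_abs_def)

lemma rat_padic_abs_frac:
  assumes p: "prime p" and a: "a \<noteq> 0" and b: "b \<noteq> 0"
  shows "rat_padic_abs p (of_int a / of_int b)
           = real p powi (int (multiplicity (int p) b) - int (multiplicity (int p) a))"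
proof -
  let ?x = "of_int a / of_int b :: rat"
  obtain c d where q: "quotient_of ?x = (c, d)" by fastforce
  have x0: "?x \<noteq> 0" using a b by simp
  have d: "d > 0" using quotient_of_denom_pos[OF q] .
  have e: "?x = of_int c / of_int d" using quotient_of_div[OF q] .
  have c: "c \<noteq> 0" using e x0 by auto
  have "(of_int (a * d) :: rat) = of_int (c * b)"
    using e b d by (simp add: field_simps)
  hence ad: "a * d = c * b" by (simp only: of_int_eq_iff)
  have pe: "prime_elem (int p)" using p by (simp add: prime_imp_prime_elem)
  have "multiplicity (int p) a + multiplicity (int p) d
      = multiplicity (int p) c + multiplicity (int p) b"
    using ad prime_elem_multiplicity_mult_distrib[OF pe a, of d]
      prime_elem_multiplicity_mult_distrib[OF pe c b] d by simp
  hence "int (multiplicity (int p) d) - int (multiplicity (int p) c)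
      = int (multiplicity (int p) b) - int (multiplicity (int p) a)" by linarith
  thus ?thesis using x0 q by (simp add: rat_padic_abs_def)
qed

lemma rat_as_frac: obtains a b :: int where "b \<noteq> 0" "(x::rat) = of_int a / of_int b"
proof -
  obtain c d where q: "quotient_of x = (c, d)" by fastforce
  show ?thesis
    using that[of d c] quotient_of_denom_pos[OF q] quotient_of_div[OF q] by auto
qed

lemma rat_padic_abs_1 [simp]: "rat_padic_abs p 1 = 1"
  by (simp add: rat_padic_abs_def)

lemma rat_padic_abs_nonneg: "rat_padic_abs p x \<ge> 0"
  by (simp add: rat_padic_abs_def)

lemma rat_padic_abs_eq_0_iff: "prime p \<Longrightarrow> rat_padic_abs p x = 0 \<longleftrightarrow> x = 0"
  by (auto simp: rat_padic_abs_def dest: prime_gt_0_nat)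

lemma rat_padic_abs_prime:
  assumes "prime p" shows "rat_padic_abs p (of_nat p) = 1 / real p"
proof -
  have "p > 0" using assms prime_gt_0_nat by blast
  moreover have "multiplicity (int p) (int p) = 1"
    using assms by (intro multiplicity_self) (auto simp: prime_nat_iff)
  ultimately show ?thesis
    using rat_padic_abs_frac[OF assms, of "int p" 1] by (simp add: power_int_minus divide_inverse)
qed

lemma rat_padic_abs_mult:
  assumes p: "prime p"
  shows "rat_padic_abs p (x * y) = rat_padic_abs p x * rat_padic_abs p y"
proof (cases "x = 0 \<or> y = 0")
  case True thus ?thesis by auto
next
  case False
  obtain a b where ab: "b \<noteq> 0" "x = of_int a / of_int b" by (rule rat_as_frac)
  obtain c d where cd: "d \<noteq> 0" "y = of_int c / of_int d" by (rule rat_as_frac)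
  have nz: "a \<noteq> 0" "c \<noteq> 0" using False ab cd by auto
  have pe: "prime_elem (int p)" using p by (simp add: prime_imp_prime_elem)
  have p0: "real p \<noteq> 0" using p prime_gt_0_nat by fastforce
  have "x * y = of_int (a * c) / of_int (b * d)" using ab cd by simp
  hence "rat_padic_abs p (x * y)
      = real p powi (int (multiplicity (int p) (b * d)) - int (multiplicity (int p) (a * c)))"
    using rat_padic_abs_frac[OF p, of "a * c" "b * d"] nz ab cd by simp
  also have "\<dots> = real p powi ((int (multiplicity (int p) b) - int (multiplicity (int p) a))
      + (int (multiplicity (int p) d) - int (multiplicity (int p) c)))"
    using nz ab cd by (simp add: prime_elem_multiplicity_mult_distrib[OF pe] algebra_simps)
  also have "\<dots> = rat_padic_abs p x * rat_padic_abs p y"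
    using nz ab cd p0 by (simp add: rat_padic_abs_frac[OF p] power_int_add)
  finally show ?thesis .
qed

lemma rat_padic_abs_minus [simp]: "rat_padic_abs p (- x) = rat_padic_abs p x"
  by (cases "quotient_of x") (simp add: rat_padic_abs_def rat_uminus_code)

lemma rat_padic_abs_diff_commute: "rat_padic_abs p (x - y) = rat_padic_abs p (y - x)"
  by (metis minus_diff_eq rat_padic_abs_minus)

lemma rat_padic_abs_inverse:
  assumes "prime p" shows "rat_padic_abs p (inverse x) = inverse (rat_padic_abs p x)"
proof (cases "x = 0")
  case False
  have "rat_padic_abs p x * rat_padic_abs p (inverse x) = 1"
    using False by (simp flip: rat_padic_abs_mult[OF assms])
  thus ?thesis by (metis inverse_unique)
qed simp

lemma rat_padic_abs_add:
  assumes p: "prime p"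
  shows "rat_padic_abs p (x + y) \<le> max (rat_padic_abs p x) (rat_padic_abs p y)"
proof (cases "x = 0 \<or> y = 0 \<or> x + y = 0")
  case True thus ?thesis using rat_padic_abs_nonneg by (auto simp: le_max_iff_disj)
next
  case False
  obtain a b where ab: "b \<noteq> 0" "x = of_int a / of_int b" by (rule rat_as_frac)
  obtain c d where cd: "d \<noteq> 0" "y = of_int c / of_int d" by (rule rat_as_frac)
  define u v e where uve: "u = a * d" "v = c * b" "e = b * d"
  have x: "x = of_int u / of_int e" and y: "y = of_int v / of_int e" and e: "e \<noteq> 0"
    using ab cd by (auto simp: uve)
  have xy: "x + y = of_int (u + v) / of_int e" using x y by (simp add: add_divide_distrib)
  have nz: "u \<noteq> 0" "v \<noteq> 0" "u + v \<noteq> 0" using False x y xy by auto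
  let ?m = "multiplicity (int p)"
  have p1: "real p \<ge> 1" using p prime_ge_1_nat by fastforce
  have nu: "\<not> is_unit (int p)" using p by (auto simp: prime_nat_iff)
  have "int p ^ min (?m u) (?m v) dvd u + v"
    by (intro dvd_add) (auto intro!: multiplicity_dvd')
  hence "min (?m u) (?m v) \<le> ?m (u + v)"
    using nz nu by (intro multiplicity_geI) auto
  hence "?m u \<le> ?m (u + v) \<or> ?m v \<le> ?m (u + v)" by linarith
  thus ?thesis
  proof
    assume "?m u \<le> ?m (u + v)"
    hence "rat_padic_abs p (x + y) \<le> rat_padic_abs p x"
      unfolding xy using nz e p1 unfolding x
      by (subst (1 2) rat_padic_abs_frac[OF p]) (auto intro!: power_int_increasing)
    thus ?thesis by simp
  next
    assume "?m v \<le> ?m (u + v)"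
    hence "rat_padic_abs p (x + y) \<le> rat_padic_abs p y"
      unfolding xy using nz e p1 unfolding y
      by (subst (1 2) rat_padic_abs_frac[OF p]) (auto intro!: power_int_increasing)
    thus ?thesis by simp
  qed
qed

lemma rat_padic_abs_triangle:
  assumes "prime p" shows "rat_padic_abs p (x + y) \<le> rat_padic_abs p x + rat_padic_abs p y"
  using rat_padic_abs_add[OF assms, of x y] rat_padic_abs_nonneg[of p x] rat_padic_abs_nonneg[of p y]
  by linarith

lemma rat_padic_abs_diff_ge:
  assumes "prime p"
  shows "\<bar>rat_padic_abs p x - rat_padic_abs p y\<bar> \<le> rat_padic_abs p (x - y)"
  using rat_padic_abs_triangle[OF assms, of "x - y" y] rat_padic_abs_triangle[OF assms, of "y - x" x]
    rat_padic_abs_diff_commute[of p x y]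
  by auto


section \<open>The field of \<open>p\<close>-adic numbers\<close>

text \<open>\<open>Qp p\<close> is the completion of the rationals with respect to the \<open>p\<close>-adic absolute value:
  Cauchy sequences modulo null sequences.\<close>

definition padic_Cauchy :: "nat \<Rightarrow> (nat \<Rightarrow> rat) \<Rightarrow> bool" where
  "padic_Cauchy p s \<longleftrightarrow> (\<forall>e>0. \<exists>N. \<forall>m\<ge>N. \<forall>n\<ge>N. rat_padic_abs p (s m - s n) < e)"

definition padic_Cauchy_ring :: "nat \<Rightarrow> (nat \<Rightarrow> rat) ring" where
  "padic_Cauchy_ring p =
     \<lparr>carrier = {s. padic_Cauchy p s}, mult = (\<lambda>s t n. s n * t n), one = (\<lambda>n. 1),
      zero = (\<lambda>n. 0), add = (\<lambda>s t n. s n + t n)\<rparr>"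

definition padic_null :: "nat \<Rightarrow> (nat \<Rightarrow> rat) set" where
  "padic_null p = {s. (\<lambda>n. rat_padic_abs p (s n)) \<longlonglongrightarrow> 0}"

definition Qp :: "nat \<Rightarrow> (nat \<Rightarrow> rat) set ring" where
  "Qp p = padic_Cauchy_ring p Quot padic_null p"

definition Qp_of_rat :: "nat \<Rightarrow> rat \<Rightarrow> (nat \<Rightarrow> rat) set" where
  "Qp_of_rat p x = padic_null p +>\<^bsub>padic_Cauchy_ring p\<^esub> (\<lambda>n. x)"

definition Qp_abs :: "nat \<Rightarrow> (nat \<Rightarrow> rat) set \<Rightarrow> real" where
  "Qp_abs p X = (THE l. \<forall>s\<in>X. (\<lambda>n. rat_padic_abs p (s n)) \<longlonglongrightarrow> l)"

definition Qp_poly :: "nat \<Rightarrow> rat poly \<Rightarrow> (nat \<Rightarrow> rat) set \<Rightarrow> (nat \<Rightarrow> rat) set" where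
  "Qp_poly p g X =
     (\<Oplus>\<^bsub>Qp p\<^esub> i\<in>{..degree g}. Qp_of_rat p (coeff g i) \<otimes>\<^bsub>Qp p\<^esub> X [^]\<^bsub>Qp p\<^esub> i)"

text \<open>The witness \<open>g\<close> is the minimal polynomial of \<open>X\<close> over the rationals.\<close>

definition Qp_algebraic_of_degree :: "nat \<Rightarrow> nat \<Rightarrow> (nat \<Rightarrow> rat) set \<Rightarrow> bool" where
  "Qp_algebraic_of_degree p d X \<longleftrightarrow>
     (\<exists>g :: rat poly. irreducible g \<and> lead_coeff g = 1 \<and> degree g = d \<and> Qp_poly p g X = \<zero>\<^bsub>Qp p\<^esub>)"


subsection \<open>Well-definedness\<close>

lemma padic_Cauchy_ring_simps [simp]:
  "carrier (padic_Cauchy_ring p) = {s. padic_Cauchy p s}"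
  "s \<otimes>\<^bsub>padic_Cauchy_ring p\<^esub> t = (\<lambda>n. s n * t n)"
  "\<one>\<^bsub>padic_Cauchy_ring p\<^esub> = (\<lambda>n. 1)"
  "s \<oplus>\<^bsub>padic_Cauchy_ring p\<^esub> t = (\<lambda>n. s n + t n)"
  "\<zero>\<^bsub>padic_Cauchy_ring p\<^esub> = (\<lambda>n. 0)"
  by (simp_all add: padic_Cauchy_ring_def)

lemma padic_CauchyD:
  assumes "padic_Cauchy p s" "e > 0"
  obtains N where "\<And>m n. m \<ge> N \<Longrightarrow> n \<ge> N \<Longrightarrow> rat_padic_abs p (s m - s n) < e"
  using assms unfolding padic_Cauchy_def by meson

lemma padic_Cauchy_const: "padic_Cauchy p (\<lambda>n. x)"
  by (simp add: padic_Cauchy_def)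

lemma padic_Cauchy_minus: "padic_Cauchy p s \<Longrightarrow> padic_Cauchy p (\<lambda>n. - s n)"
  unfolding padic_Cauchy_def by (simp add: rat_padic_abs_diff_commute)

lemma padic_Cauchy_add:
  assumes p: "prime p" and s: "padic_Cauchy p s" and t: "padic_Cauchy p t"
  shows "padic_Cauchy p (\<lambda>n. s n + t n)"
  unfolding padic_Cauchy_def
proof (intro allI impI)
  fix e :: real assume e: "e > 0"
  obtain M where M: "\<And>m n. m \<ge> M \<Longrightarrow> n \<ge> M \<Longrightarrow> rat_padic_abs p (s m - s n) < e"
    using padic_CauchyD[OF s e] by blast
  obtain N where N: "\<And>m n. m \<ge> N \<Longrightarrow> n \<ge> N \<Longrightarrow> rat_padic_abs p (t m - t n) < e"
    using padic_CauchyD[OF t e] by blast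
  have "rat_padic_abs p ((s m + t m) - (s n + t n)) < e" if "m \<ge> max M N" "n \<ge> max M N" for m n
  proof -
    have "(s m + t m) - (s n + t n) = (s m - s n) + (t m - t n)" by simp
    moreover have "rat_padic_abs p ((s m - s n) + (t m - t n)) < e"
      using le_less_trans[OF rat_padic_abs_add[OF p, of "s m - s n" "t m - t n"], of e]
        M[of m n] N[of m n] that by simp
    ultimately show ?thesis by (simp only:)
  qed
  thus "\<exists>N. \<forall>m\<ge>N. \<forall>n\<ge>N. rat_padic_abs p ((s m + t m) - (s n + t n)) < e" by blast
qed

lemma padic_Cauchy_bounded:
  assumes p: "prime p" and s: "padic_Cauchy p s"
  obtains B where "B > 0" "\<And>n. rat_padic_abs p (s n) \<le> B"
proof -
  obtain N where N: "\<And>m n. m \<ge> N \<Longrightarrow> n \<ge> N \<Longrightarrow> rat_padic_abs p (s m - s n) < 1"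
    using padic_CauchyD[OF s, of 1] by auto
  define B where "B = 1 + (\<Sum>i\<le>N. rat_padic_abs p (s i))"
  have pos: "(\<Sum>i\<le>N. rat_padic_abs p (s i)) \<ge> 0"
    by (intro sum_nonneg rat_padic_abs_nonneg)
  have le: "rat_padic_abs p (s i) \<le> (\<Sum>i\<le>N. rat_padic_abs p (s i))" if "i \<le> N" for i
    using that by (intro member_le_sum) (auto simp: rat_padic_abs_nonneg)
  have "rat_padic_abs p (s n) \<le> B" for n
  proof (cases "n \<le> N")
    case True thus ?thesis using le[of n] by (simp add: B_def)
  next
    case False
    have "rat_padic_abs p (s n) \<le> rat_padic_abs p (s n - s N) + rat_padic_abs p (s N)"
      using rat_padic_abs_triangle[OF p, of "s n - s N" "s N"] by simp
    thus ?thesis using N[of n N] le[of N] False by (simp add: B_def)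
  qed
  moreover have "B > 0" using pos by (simp add: B_def)
  ultimately show ?thesis using that by blast
qed

lemma padic_Cauchy_mult:
  assumes p: "prime p" and s: "padic_Cauchy p s" and t: "padic_Cauchy p t"
  shows "padic_Cauchy p (\<lambda>n. s n * t n)"
  unfolding padic_Cauchy_def
proof (intro allI impI)
  fix e :: real assume e: "e > 0"
  obtain B where B: "B > 0" "\<And>n. rat_padic_abs p (s n) \<le> B" using padic_Cauchy_bounded[OF p s] by blast
  obtain C where C: "C > 0" "\<And>n. rat_padic_abs p (t n) \<le> C" using padic_Cauchy_bounded[OF p t] by blast
  obtain M where M: "\<And>m n. m \<ge> M \<Longrightarrow> n \<ge> M \<Longrightarrow> rat_padic_abs p (s m - s n) < e / C"
    using padic_CauchyD[OF s, of "e / C"] e C by auto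
  obtain N where N: "\<And>m n. m \<ge> N \<Longrightarrow> n \<ge> N \<Longrightarrow> rat_padic_abs p (t m - t n) < e / B"
    using padic_CauchyD[OF t, of "e / B"] e B by auto
  have "rat_padic_abs p (s m * t m - s n * t n) < e" if "m \<ge> max M N" "n \<ge> max M N" for m n
  proof -
    have eq: "s m * t m - s n * t n = (s m - s n) * t m + s n * (t m - t n)"
      by (simp add: algebra_simps)
    have "rat_padic_abs p (s m - s n) * rat_padic_abs p (t m) \<le> rat_padic_abs p (s m - s n) * C"
      using C by (intro mult_left_mono) (auto simp: rat_padic_abs_nonneg)
    also have "\<dots> < e" using M[of m n] that C by (simp add: field_simps)
    finally have 1: "rat_padic_abs p (s m - s n) * rat_padic_abs p (t m) < e" .
    have "rat_padic_abs p (s n) * rat_padic_abs p (t m - t n) \<le> B * rat_padic_abs p (t m - t n)"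
      using B by (intro mult_right_mono) (auto simp: rat_padic_abs_nonneg)
    also have "\<dots> < e" using N[of m n] that B by (simp add: field_simps)
    finally have 2: "rat_padic_abs p (s n) * rat_padic_abs p (t m - t n) < e" .
    show ?thesis
      unfolding eq
      using rat_padic_abs_add[OF p, of "(s m - s n) * t m" "s n * (t m - t n)"] 1 2
      by (simp add: rat_padic_abs_mult[OF p])
  qed
  thus "\<exists>N. \<forall>m\<ge>N. \<forall>n\<ge>N. rat_padic_abs p (s m * t m - s n * t n) < e" by blast
qed

lemma cring_padic_Cauchy_ring:
  assumes p: "prime p" shows "cring (padic_Cauchy_ring p)"
proof (rule cringI)
  show "abelian_group (padic_Cauchy_ring p)"
  proof (rule abelian_groupI, goal_cases)
    case (6 x)
    thus ?case
      by (intro bexI[of _ "\<lambda>n. - x n"]) (auto simp: padic_Cauchy_minus)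
  qed (auto simp: padic_Cauchy_const padic_Cauchy_add[OF p] algebra_simps)
  show "comm_monoid (padic_Cauchy_ring p)"
    by (rule comm_monoidI) (auto simp: padic_Cauchy_const padic_Cauchy_mult[OF p] algebra_simps)
qed (auto simp: algebra_simps)

lemma padic_Cauchy_ring_minus:
  assumes p: "prime p" and s: "padic_Cauchy p s"
  shows "\<ominus>\<^bsub>padic_Cauchy_ring p\<^esub> s = (\<lambda>n. - s n)"
proof -
  interpret cring "padic_Cauchy_ring p" using p by (rule cring_padic_Cauchy_ring)
  show ?thesis
    by (rule minus_equality) (use s in \<open>auto simp: padic_Cauchy_minus\<close>)
qed

lemma padic_nullD:
  assumes "s \<in> padic_null p" "e > 0"
  obtains N where "\<And>n. n \<ge> N \<Longrightarrow> rat_padic_abs p (s n) < e"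
proof -
  have "\<exists>N. \<forall>n\<ge>N. norm (rat_padic_abs p (s n) - 0) < e"
    using assms LIMSEQ_D[of _ 0 e] unfolding padic_null_def by blast
  thus ?thesis using that by (auto simp: rat_padic_abs_nonneg)
qed

lemma padic_null_Cauchy:
  assumes p: "prime p" and s: "s \<in> padic_null p" shows "padic_Cauchy p s"
  unfolding padic_Cauchy_def
proof (intro allI impI)
  fix e :: real assume e: "e > 0"
  obtain N where N: "\<And>n. n \<ge> N \<Longrightarrow> rat_padic_abs p (s n) < e"
    using padic_nullD[OF s e] by blast
  have "rat_padic_abs p (s m - s n) < e" if "m \<ge> N" "n \<ge> N" for m n
    using rat_padic_abs_add[OF p, of "s m" "- s n"] N[of m] N[of n] that by auto
  thus "\<exists>N. \<forall>m\<ge>N. \<forall>n\<ge>N. rat_padic_abs p (s m - s n) < e" by blast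
qed

lemma padic_null_add:
  assumes p: "prime p" and "s \<in> padic_null p" "t \<in> padic_null p"
  shows "(\<lambda>n. s n + t n) \<in> padic_null p"
proof -
  have "(\<lambda>n. rat_padic_abs p (s n) + rat_padic_abs p (t n)) \<longlonglongrightarrow> 0 + 0"
    using assms by (intro tendsto_add) (auto simp: padic_null_def)
  hence "(\<lambda>n. rat_padic_abs p (s n) + rat_padic_abs p (t n)) \<longlonglongrightarrow> 0" by simp
  hence "(\<lambda>n. rat_padic_abs p (s n + t n)) \<longlonglongrightarrow> 0"
    by (rule tendsto_sandwich[OF _ _ tendsto_const, rotated 2])
       (auto simp: rat_padic_abs_nonneg rat_padic_abs_triangle[OF p])
  thus ?thesis by (simp add: padic_null_def)
qed

lemma padic_null_mult:
  assumes p: "prime p" and s: "s \<in> padic_null p" and t: "padic_Cauchy p t"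
  shows "(\<lambda>n. t n * s n) \<in> padic_null p"
proof -
  obtain B where B: "B > 0" "\<And>n. rat_padic_abs p (t n) \<le> B" using padic_Cauchy_bounded[OF p t] by blast
  have "(\<lambda>n. B * rat_padic_abs p (s n)) \<longlonglongrightarrow> B * 0"
    using s by (intro tendsto_mult tendsto_const) (auto simp: padic_null_def)
  hence "(\<lambda>n. B * rat_padic_abs p (s n)) \<longlonglongrightarrow> 0" by simp
  hence "(\<lambda>n. rat_padic_abs p (t n * s n)) \<longlonglongrightarrow> 0"
    by (rule tendsto_sandwich[OF _ _ tendsto_const, rotated 2])
       (auto simp: rat_padic_abs_nonneg rat_padic_abs_mult[OF p] B intro!: always_eventually mult_right_mono)
  thus ?thesis by (simp add: padic_null_def)
qed

lemma ideal_padic_null: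
  assumes p: "prime p" shows "ideal (padic_null p) (padic_Cauchy_ring p)"
proof (rule idealI)
  interpret cring "padic_Cauchy_ring p" using p by (rule cring_padic_Cauchy_ring)
  show "ring (padic_Cauchy_ring p)" by (rule ring_axioms)
  show "subgroup (padic_null p) (add_monoid (padic_Cauchy_ring p))"
  proof (rule add.subgroupI)
    show "padic_null p \<subseteq> carrier (padic_Cauchy_ring p)" using padic_null_Cauchy[OF p] by auto
    have "(\<lambda>n. 0) \<in> padic_null p" by (simp add: padic_null_def)
    thus "padic_null p \<noteq> {}" by auto
    show "\<ominus>\<^bsub>padic_Cauchy_ring p\<^esub> s \<in> padic_null p" if "s \<in> padic_null p" for s
      using that padic_Cauchy_ring_minus[OF p padic_null_Cauchy[OF p that]]
      by (simp add: padic_null_def)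
  qed (auto simp: padic_null_add[OF p])
next
  fix a x assume a: "a \<in> padic_null p" "x \<in> carrier (padic_Cauchy_ring p)"
  hence "(\<lambda>n. x n * a n) \<in> padic_null p" by (simp add: padic_null_mult[OF p])
  thus "x \<otimes>\<^bsub>padic_Cauchy_ring p\<^esub> a \<in> padic_null p"
    and "a \<otimes>\<^bsub>padic_Cauchy_ring p\<^esub> x \<in> padic_null p"
    by (simp_all add: mult.commute)
qed

lemma padic_not_null_bounded_below:
  assumes p: "prime p" and s: "padic_Cauchy p s" and "s \<notin> padic_null p"
  obtains d N where "d > 0" "\<And>n. n \<ge> N \<Longrightarrow> rat_padic_abs p (s n) \<ge> d"
proof -
  obtain e where e: "e > 0" and inf: "\<And>N. \<exists>n\<ge>N. rat_padic_abs p (s n) \<ge> e"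
    using assms(3) unfolding padic_null_def LIMSEQ_def
    by (auto simp: rat_padic_abs_nonneg not_less)
  obtain N where N: "\<And>m n. m \<ge> N \<Longrightarrow> n \<ge> N \<Longrightarrow> rat_padic_abs p (s m - s n) < e / 2"
    using padic_CauchyD[OF s, of "e / 2"] e by auto
  obtain k where k: "k \<ge> N" "rat_padic_abs p (s k) \<ge> e" using inf by blast
  have "rat_padic_abs p (s n) \<ge> e / 2" if "n \<ge> N" for n
    using rat_padic_abs_triangle[OF p, of "s k - s n" "s n"] N[of k n] k that by simp
  thus ?thesis using that[of "e / 2" N] e by simp
qed

lemma padic_Cauchy_inverse:
  assumes p: "prime p" and s: "padic_Cauchy p s" and nn: "s \<notin> padic_null p"
  shows "padic_Cauchy p (\<lambda>n. inverse (s n))"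
  unfolding padic_Cauchy_def
proof (intro allI impI)
  fix e :: real assume e: "e > 0"
  obtain d M where d: "d > 0" and M: "\<And>n. n \<ge> M \<Longrightarrow> rat_padic_abs p (s n) \<ge> d"
    using padic_not_null_bounded_below[OF p s nn] by blast
  obtain N where N: "\<And>m n. m \<ge> N \<Longrightarrow> n \<ge> N \<Longrightarrow> rat_padic_abs p (s m - s n) < e * (d * d)"
    using padic_CauchyD[OF s, of "e * (d * d)"] e d by auto
  have "rat_padic_abs p (inverse (s m) - inverse (s n)) < e" if "m \<ge> max M N" "n \<ge> max M N" for m n
  proof -
    have dm: "rat_padic_abs p (s m) \<ge> d" and dn: "rat_padic_abs p (s n) \<ge> d"
      using M that by auto
    hence nz: "s m \<noteq> 0" "s n \<noteq> 0" using d by auto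
    have "inverse (s m) - inverse (s n) = (s n - s m) * inverse (s m * s n)"
      using nz by (simp add: field_simps)
    hence eq: "rat_padic_abs p (inverse (s m) - inverse (s n))
        = rat_padic_abs p (s n - s m) / (rat_padic_abs p (s m) * rat_padic_abs p (s n))"
      by (simp add: rat_padic_abs_mult[OF p] rat_padic_abs_inverse[OF p] divide_inverse)
    have dd: "d * d \<le> rat_padic_abs p (s m) * rat_padic_abs p (s n)"
      using dm dn d by (intro mult_mono) auto
    have "rat_padic_abs p (s n - s m) < e * (d * d)" using N[of n m] that by simp
    also have "\<dots> \<le> e * (rat_padic_abs p (s m) * rat_padic_abs p (s n))"
      using dd e by (intro mult_left_mono) auto
    finally show ?thesis
      using dd d unfolding eq by (subst pos_divide_less_eq) (auto intro: less_le_trans[OF mult_pos_pos])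
  qed
  thus "\<exists>N. \<forall>m\<ge>N. \<forall>n\<ge>N. rat_padic_abs p (inverse (s m) - inverse (s n)) < e" by blast
qed

lemma maximalideal_padic_null:
  assumes p: "prime p" shows "maximalideal (padic_null p) (padic_Cauchy_ring p)"
proof (rule maximalidealI)
  show "ideal (padic_null p) (padic_Cauchy_ring p)" using p by (rule ideal_padic_null)
  have "(\<lambda>n. 1) \<notin> padic_null p" by (simp add: padic_null_def LIMSEQ_const_iff)
  thus "carrier (padic_Cauchy_ring p) \<noteq> padic_null p" by (auto simp: padic_Cauchy_const)
next
  fix J assume J: "ideal J (padic_Cauchy_ring p)" and IJ: "padic_null p \<subseteq> J"
    and JC: "J \<subseteq> carrier (padic_Cauchy_ring p)"
  interpret J: ideal J "padic_Cauchy_ring p" by fact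
  show "J = padic_null p \<or> J = carrier (padic_Cauchy_ring p)"
  proof (rule disjCI)
    assume "J \<noteq> carrier (padic_Cauchy_ring p)"
    hence one: "(\<lambda>n. 1) \<notin> J" using J.one_imp_carrier by auto
    show "J = padic_null p"
    proof (rule ccontr)
      assume "J \<noteq> padic_null p"
      then obtain s where s: "s \<in> J" "s \<notin> padic_null p" using IJ by blast
      have sC: "padic_Cauchy p s" using s JC by auto
      obtain d N where d: "d > 0" and N: "\<And>n. n \<ge> N \<Longrightarrow> rat_padic_abs p (s n) \<ge> d"
        using padic_not_null_bounded_below[OF p sC s(2)] by blast
      have st: "(\<lambda>n. s n * inverse (s n)) \<in> J"
        using J.I_r_closed[OF s(1), of "\<lambda>n. inverse (s n)"] padic_Cauchy_inverse[OF p sC s(2)]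
        by simp
      have "\<forall>n\<ge>N. rat_padic_abs p (1 - s n * inverse (s n)) = 0"
      proof (intro allI impI)
        fix n assume "n \<ge> N"
        hence "rat_padic_abs p (s n) > 0" using N[of n] d by linarith
        hence "s n \<noteq> 0" by auto
        thus "rat_padic_abs p (1 - s n * inverse (s n)) = 0" by simp
      qed
      hence "(\<lambda>n. 1 - s n * inverse (s n)) \<in> padic_null p"
        unfolding padic_null_def
        by (intro CollectI tendsto_eventually eventually_sequentiallyI[of N]) blast
      hence "(\<lambda>n. 1 - s n * inverse (s n)) \<in> J" using IJ by blast
      from additive_subgroup.a_closed[OF J.additive_subgroup_axioms this st] have "(\<lambda>n. 1) \<in> J" by simp
      thus False using one by simp
    qed
  qed
qed

theorem field_Qp: "prime p \<Longrightarrow> field (Qp p)"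
  unfolding Qp_def
  by (intro maximalideal.quotient_is_field maximalideal_padic_null cring_padic_Cauchy_ring)

lemma carrier_Qp:
  "carrier (Qp p) = {padic_null p +>\<^bsub>padic_Cauchy_ring p\<^esub> s | s. padic_Cauchy p s}"
  by (auto simp: Qp_def FactRing_def A_RCOSETS_def')

lemma Qp_of_rat_closed: "Qp_of_rat p x \<in> carrier (Qp p)"
  by (auto simp: carrier_Qp Qp_of_rat_def padic_Cauchy_const)

lemma mem_Qp_coset:
  assumes p: "prime p" and s: "padic_Cauchy p s"
  shows "t \<in> padic_null p +>\<^bsub>padic_Cauchy_ring p\<^esub> s \<longleftrightarrow> (\<lambda>n. t n - s n) \<in> padic_null p"
proof
  assume "t \<in> padic_null p +>\<^bsub>padic_Cauchy_ring p\<^esub> s"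
  thus "(\<lambda>n. t n - s n) \<in> padic_null p" by (auto simp: a_r_coset_def')
next
  assume "(\<lambda>n. t n - s n) \<in> padic_null p"
  thus "t \<in> padic_null p +>\<^bsub>padic_Cauchy_ring p\<^esub> s"
    unfolding a_r_coset_def' by (auto intro!: bexI[of _ "\<lambda>n. t n - s n"])
qed

theorem Qp_abs_coset:
  assumes p: "prime p" and s: "padic_Cauchy p s"
  shows "(\<lambda>n. rat_padic_abs p (s n)) \<longlonglongrightarrow> Qp_abs p (padic_null p +>\<^bsub>padic_Cauchy_ring p\<^esub> s)"
proof -
  let ?X = "padic_null p +>\<^bsub>padic_Cauchy_ring p\<^esub> s"
  have "Cauchy (\<lambda>n. rat_padic_abs p (s n))"
  proof (rule CauchyI)
    fix e :: real assume e: "e > 0"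
    obtain N where N: "\<And>m n. m \<ge> N \<Longrightarrow> n \<ge> N \<Longrightarrow> rat_padic_abs p (s m - s n) < e"
      using padic_CauchyD[OF s e] by blast
    show "\<exists>M. \<forall>m\<ge>M. \<forall>n\<ge>M. norm (rat_padic_abs p (s m) - rat_padic_abs p (s n)) < e"
      by (intro exI[of _ N])
         (auto intro: le_less_trans[OF rat_padic_abs_diff_ge[OF p] N])
  qed
  then obtain l where l: "(\<lambda>n. rat_padic_abs p (s n)) \<longlonglongrightarrow> l"
    using Cauchy_convergent_iff convergent_def by blast
  have all: "(\<lambda>n. rat_padic_abs p (t n)) \<longlonglongrightarrow> l" if "t \<in> ?X" for t
  proof -
    have "(\<lambda>n. rat_padic_abs p (t n - s n)) \<longlonglongrightarrow> 0"
      using that mem_Qp_coset[OF p s] by (simp add: padic_null_def)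
    hence "(\<lambda>n. rat_padic_abs p (t n) - rat_padic_abs p (s n)) \<longlonglongrightarrow> 0"
      by (rule tendsto_0_le[where K = 1])
         (auto simp: rat_padic_abs_diff_ge[OF p] rat_padic_abs_nonneg)
    from tendsto_add[OF this l] show ?thesis by simp
  qed
  have self: "s \<in> ?X" using mem_Qp_coset[OF p s, of s] by (simp add: padic_null_def)
  have "Qp_abs p ?X = l"
    unfolding Qp_abs_def
    by (rule the_equality) (use all self LIMSEQ_unique[OF l] in blast)+
  thus ?thesis using l by simp
qed

lemma Qp_abs_of_rat: "prime p \<Longrightarrow> Qp_abs p (Qp_of_rat p x) = rat_padic_abs p x"
  unfolding Qp_of_rat_def
  using Qp_abs_coset[OF _ padic_Cauchy_const, of p x] by (simp add: LIMSEQ_const_iff)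

end

theory Submission
  imports
    Defs
    "HOL-Analysis.Kronecker_Approximation_Theorem"
    "HOL-Number_Theory.Cong"
    "HOL-Computational_Algebra.Field_as_Ring"
begin

text \<open>
  Up to an integral linear change of \<open>(Q, R)\<close> one may replace \<open>\<beta>\<close> by a quadratic integer \<open>\<gamma> \<in> \<int>\<^sub>p\<close> whose
  discriminant is prime to \<open>p\<close>. Thue's lemma and the pigeonhole principle produce \<open>\<rho> \<in> \<int>[\<gamma>]\<close> of norm \<open>p\<^sup>h\<close>
  whose conjugate is a \<open>p\<close>-adic unit. Thus \<open>\<rho>\<^sup>k = A + B \<gamma>\<close> has \<open>p\<close>-adic absolute value \<open>p\<close> to the power
  \<open>- h k\<close>, while its conjugates at infinity have geometric mean \<open>r\<^sup>k\<close> with \<open>r\<^sup>2 = p\<^sup>h\<close>.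
  If \<open>\<gamma>\<close> is imaginary, \<open>A\<close> and \<open>B\<close> are of size \<open>r\<^sup>k\<close> and \<open>A + B \<alpha>\<close> is a constant times \<open>r\<^sup>k sin (k \<phi> + \<psi>)\<close>,
  where \<open>\<phi> / \<pi>\<close> is irrational because no power of \<open>\<rho>\<close> is rational. If \<open>\<gamma>\<close> is real, one first multiplies
  \<open>\<rho>\<^sup>k\<close> by a power of a unit coming from Pell's equation. In both cases \<open>|k \<theta> - l - x| \<le> 6 / k\<close> has infinitely
  many solutions for irrational \<open>\<theta>\<close>, so \<open>|A + B \<alpha>|\<close> is at most a constant times \<open>r\<^sup>k / k\<close> infinitely often,
  and \<open>k\<close> is comparable to the logarithm of the height.
\<close>

section \<open>Diophantine approximation and Pell's equation\<close>

text \<open>A fraction \<open>h / q\<close> with error below \<open>1 / q^2\<close> and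
  \<open>q > N\<close> moves \<open>k * \<theta>\<close> to within \<open>2 / q\<close> of
  \<open>k * h / q\<close>, and \<open>k\<close> may be chosen so that \<open>h * k\<close> is
  congruent modulo \<open>q\<close> to the integer part of \<open>q * x\<close>. The two errors add
  up to \<open>3 / q\<close>.\<close>

lemma inhomogeneous_approx:
  fixes \<theta> x :: real
  assumes "\<theta> \<notin> \<rat>"
  obtains k :: nat and l :: int where "k > N" "\<bar>real k * \<theta> - of_int l - x\<bar> \<le> 6 / real k"
proof -
  have "infinite (approx_set \<theta>)" using assms rational_iff_finite_approx_set by blast
  then obtain h q where hq: "(h, q) \<in> approx_set \<theta>" "q > int N"
    using infinite_approx_set by blast
  hence cop: "coprime h q" and q0: "q > 0" and close: "\<bar>\<theta> - of_int h / of_int q\<bar> < 1 / (of_int q)\<^sup>2"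
    by (auto simp: approx_set_def)
  define c where "c = \<lfloor>of_int q * x\<rfloor>"
  obtain u where u: "[h * u = 1] (mod q)" using cong_solve_coprime_int[OF cop] by blast
  \<comment> \<open>Adding \<open>q\<close> to the residue keeps \<open>k\<close> in
    \<open>[q, 2q)\<close>: then \<open>k\<close> exceeds \<open>N\<close>, and \<open>3 / q\<close>
    becomes at most \<open>6 / k\<close>.\<close>
  define k where "k = q + (c * u) mod q"
  have kb: "q \<le> k" "k < 2 * q" using q0 by (auto simp: k_def)
  have "[k = c * u] (mod q)" by (simp add: k_def cong_def)
  hence "[h * k = h * (c * u)] (mod q)" by (rule cong_scalar_left)
  also have "h * (c * u) = c * (h * u)" by simp
  also have "[c * (h * u) = c * 1] (mod q)" using u by (rule cong_scalar_left)
  finally have "q dvd h * k - c" by (simp add: cong_iff_dvd_diff)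
  then obtain l where l: "h * k - c = q * l" by (auto elim: dvdE)
  have rl: "of_int h * of_int k = (of_int c + of_int q * of_int l :: real)"
    using l by (metis add.commute add_diff_cancel_left' diff_add_cancel of_int_add of_int_mult)
  have eq: "of_int k * \<theta> - of_int l - x
      = of_int k * (\<theta> - of_int h / of_int q) + (of_int c - of_int q * x) / of_int q"
    using q0 rl by (simp add: field_simps)
  have 1: "\<bar>of_int k * (\<theta> - of_int h / of_int q)\<bar> \<le> 2 / of_int q"
  proof -
    have "\<bar>of_int k * (\<theta> - of_int h / of_int q)\<bar> \<le> (2 * of_int q) * (1 / (of_int q)\<^sup>2)"
      unfolding abs_mult using kb q0 close by (intro mult_mono) auto
    also have "\<dots> = 2 / of_int q" using q0 by (simp add: power2_eq_square)
    finally show ?thesis .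
  qed
  have "\<bar>of_int c - of_int q * x\<bar> \<le> 1" unfolding c_def by linarith
  hence 2: "\<bar>(of_int c - of_int q * x) / of_int q\<bar> \<le> 1 / of_int q"
    using q0 by (simp add: divide_right_mono abs_divide)
  have "\<bar>of_int k * \<theta> - of_int l - x\<bar> \<le> 3 / of_int q"
    unfolding eq using 1 2 abs_triangle_ineq[of "of_int k * (\<theta> - of_int h / of_int q)"
        "(of_int c - of_int q * x) / of_int q"] by (simp add: add_divide_distrib[symmetric])
  also have "\<dots> \<le> 6 / of_int k" using kb q0 by (simp add: field_simps)
  finally have "\<bar>real (nat k) * \<theta> - of_int l - x\<bar> \<le> 6 / real (nat k)" using kb q0 by simp
  thus ?thesis using that[of "nat k" l] kb hq by linarith
qed

text \<open>Dirichlet's argument: the infinitely many pairs in \<open>approx_set w\<close> have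
  norms bounded by \<open>2 * w + 1\<close>, so two of them share their norm \<open>c\<close> and
  are congruent modulo \<open>c\<close>. Their quotient is then integral of norm 1.\<close>

lemma Pell_solution_exists:
  fixes D :: int
  assumes D: "D > 0" and nonsq: "\<And>x y :: int. x\<^sup>2 = D * y\<^sup>2 \<Longrightarrow> y = 0"
  obtains x y :: int where "x\<^sup>2 - D * y\<^sup>2 = 1" "y \<noteq> 0"
proof -
  define w where "w = sqrt (of_int D)"
  have w: "w > 0" "w\<^sup>2 = of_int D" using D by (auto simp: w_def)
  have "w \<notin> \<rat>"
  proof
    assume "w \<in> \<rat>"
    then obtain a b :: int where ab: "w = of_int a / of_int b" "b > 0" by (meson Rats_cases')
    have "(of_int (a\<^sup>2) :: real) = of_int (D * b\<^sup>2)"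
      using w(2) ab by (simp add: field_simps power2_eq_square)
    hence "a\<^sup>2 = D * b\<^sup>2" by (simp only: of_int_eq_iff)
    thus False using nonsq ab by fastforce
  qed
  hence inf: "infinite (approx_set w)" using rational_iff_finite_approx_set by blast
  define n where "n = (\<lambda>(h, k). h\<^sup>2 - D * k\<^sup>2 :: int)"
  define F where "F = (\<lambda>(h, k). (n (h, k), h mod n (h, k), k mod n (h, k)))"
  define K where "K = \<lceil>2 * w + 1\<rceil>"
  have K: "\<bar>n (h, k)\<bar> \<le> K" and n0: "n (h, k) \<noteq> 0" if "(h, k) \<in> approx_set w" for h k
  proof -
    have k: "k > 0" and close: "\<bar>w - of_int h / of_int k\<bar> < 1 / (of_int k)\<^sup>2"
      using that by (auto simp: approx_set_def)
    have "\<bar>of_int h - of_int k * w\<bar> = of_int k * \<bar>w - of_int h / of_int k\<bar>"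
      using k by (simp add: abs_mult_pos field_simps abs_minus_commute)
    also have "\<dots> \<le> of_int k * (1 / (of_int k)\<^sup>2)" using close k by (intro mult_left_mono) auto
    also have "\<dots> = 1 / of_int k" using k by (simp add: power2_eq_square)
    finally have a: "\<bar>of_int h - of_int k * w\<bar> \<le> 1 / of_int k" .
    have k1: "1 / of_int k \<le> (of_int k :: real)" "1 \<le> (of_int k :: real)"
    proof -
      show "1 \<le> (of_int k :: real)" using k by linarith
      hence "1 / of_int k \<le> (1 :: real)" by simp
      thus "1 / of_int k \<le> (of_int k :: real)" using \<open>1 \<le> (of_int k :: real)\<close> by linarith
    qed
    have b: "\<bar>of_int h + of_int k * w\<bar> \<le> of_int k * (2 * w + 1)"
    proof -
      have "\<bar>of_int h + of_int k * w\<bar> \<le> \<bar>of_int h - of_int k * w\<bar> + 2 * (of_int k * w)"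
        using w k by (smt (verit) mult_nonneg_nonneg of_int_0_le_iff)
      also have "\<dots> \<le> of_int k + 2 * (of_int k * w)" using a k1 by linarith
      finally show ?thesis by (simp add: algebra_simps)
    qed
    have "(of_int (n (h, k)) :: real) = (of_int h - of_int k * w) * (of_int h + of_int k * w)"
      by (simp add: n_def w(2)[symmetric] algebra_simps power2_eq_square)
    hence "\<bar>of_int (n (h, k)) :: real\<bar> = \<bar>of_int h - of_int k * w\<bar> * \<bar>of_int h + of_int k * w\<bar>"
      by (simp only: abs_mult)
    also have "\<dots> \<le> (1 / of_int k) * (of_int k * (2 * w + 1))"
      using a b k by (intro mult_mono) auto
    also have "\<dots> = 2 * w + 1" using k by simp
    finally show "\<bar>n (h, k)\<bar> \<le> K" unfolding K_def by linarith
    show "n (h, k) \<noteq> 0" using nonsq[of h k] k by (auto simp: n_def)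
  qed
  have mb: "\<bar>a mod c\<bar> \<le> \<bar>c\<bar>" if "c \<noteq> 0" for a c :: int
    using abs_mod_less[OF that, of a] by linarith
  have "F ` approx_set w \<subseteq> {-K..K} \<times> {-K..K} \<times> {-K..K}"
  proof safe
    fix h k c a b assume hk: "(h, k) \<in> approx_set w" "(c, a, b) = F (h, k)"
    have "c = n (h, k)" "a = h mod c" "b = k mod c" using hk(2) by (auto simp: F_def)
    thus "c \<in> {-K..K}" "a \<in> {-K..K}" "b \<in> {-K..K}"
      using K[OF hk(1)] mb[of c h] mb[of c k] n0[OF hk(1)] by auto
  qed
  hence "finite (F ` approx_set w)" by (rule finite_subset) auto
  from pigeonhole_infinite[OF inf this] obtain z where
    z: "z \<in> approx_set w" "infinite {a \<in> approx_set w. F a = F z}" by blast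
  then obtain z' where z': "z' \<in> approx_set w" "F z' = F z" "z' \<noteq> z"
    by (metis (mono_tags, lifting) finite.emptyI finite_insert infinite_super insertI1 mem_Collect_eq subsetI)
  obtain x y where xy: "z = (x, y)" by fastforce
  obtain x' y' where xy': "z' = (x', y')" by fastforce
  define c where "c = n z"
  have c: "x\<^sup>2 - D * y\<^sup>2 = c" "x'\<^sup>2 - D * y'\<^sup>2 = c" "c \<noteq> 0" "c dvd x' - x" "c dvd y' - y"
    using z'(2) n0 z(1) unfolding xy xy' c_def F_def
    by (auto simp: n_def mod_eq_dvd_iff)
  have pos: "y > 0" "y' > 0" using z z' xy xy' by (auto simp: approx_set_def)
  \<comment> \<open>\<open>X\<close> and \<open>Y\<close> will be the coefficients of
    \<open>(x - y w) (x' + y' w) / c\<close>.\<close>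
  have "x * x' - D * (y * y') = c + x * (x' - x) - D * (y * (y' - y))"
    using c(1) by (simp add: algebra_simps power2_eq_square)
  hence "c dvd x * x' - D * (y * y')" using c by (metis dvd_add dvd_diff dvd_mult dvd_refl)
  then obtain X where X: "x * x' - D * (y * y') = c * X" by (auto elim: dvdE)
  have "x * y' - x' * y = x * (y' - y) - y * (x' - x)" by (simp add: algebra_simps)
  hence "c dvd x * y' - x' * y" using c by (metis dvd_diff dvd_mult)
  then obtain Y where Y: "x * y' - x' * y = c * Y" by (auto elim: dvdE)
  have "c\<^sup>2 * (X\<^sup>2 - D * Y\<^sup>2) = (x * x' - D * (y * y'))\<^sup>2 - D * (x * y' - x' * y)\<^sup>2"
    unfolding X Y by (simp add: algebra_simps power2_eq_square)
  also have "\<dots> = (x\<^sup>2 - D * y\<^sup>2) * (x'\<^sup>2 - D * y'\<^sup>2)"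
    by (simp add: algebra_simps power2_eq_square)
  also have "\<dots> = c\<^sup>2 * 1" unfolding c by (simp add: power2_eq_square)
  finally have 1: "X\<^sup>2 - D * Y\<^sup>2 = 1" using c(3) by simp
  \<comment> \<open>If \<open>Y = 0\<close> the pairs are proportional; equal norms and positive
    second entries then force them to coincide.\<close>
  have "Y \<noteq> 0"
  proof
    assume "Y = 0"
    hence e: "x * y' = x' * y" using Y by simp
    have "c * y'\<^sup>2 = (x * y')\<^sup>2 - D * y\<^sup>2 * y'\<^sup>2" unfolding c(1)[symmetric]
      by (simp add: algebra_simps power2_eq_square)
    also have "\<dots> = c * y\<^sup>2" unfolding e c(2)[symmetric] by (simp add: algebra_simps power2_eq_square)
    finally have "y'\<^sup>2 = y\<^sup>2" using c(3) by simp
    hence "y' = y" using pos by (simp add: power2_eq_iff_nonneg)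
    thus False using e pos z'(3) xy xy' by simp
  qed
  thus ?thesis using that 1 by blast
qed

section \<open>Quadratic integers and their \<open>p\<close>-adic approximations\<close>

lemma dvd_diff_imp_dvd_iff:
  fixes a b q :: "'a :: comm_ring_1"
  assumes "q dvd a - b"
  shows "q dvd a \<longleftrightarrow> q dvd b"
  using dvd_add[OF assms, of b] dvd_diff[of q a "a - b"] assms by auto

lemma coherent_dvd_diff:
  fixes q :: "'a :: comm_ring_1"
  assumes "\<And>i. q ^ i dvd g (Suc i) - g i" and "i \<le> j"
  shows "q ^ i dvd g j - g i"
  using assms(2)
proof (induction j rule: dec_induct)
  case (step j)
  have "q ^ i dvd g (Suc j) - g j"
    using assms(1)[of j] step(1) by (meson dvd_trans le_imp_power_dvd)
  from dvd_add[OF this step(3)] show ?case by simp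
qed simp

text \<open>A pair \<open>(x, y)\<close> stands for \<open>x + y \<gamma>\<close>, where \<open>\<gamma>\<^sup>2 = t \<gamma> - n\<close>. Evaluating it at the real, complex
  or approximate \<open>p\<close>-adic roots of \<open>X\<^sup>2 - t X + n\<close> gives all the embeddings of \<open>\<int>[\<gamma>]\<close> that are needed;
  the conjugate of an embedding replaces the root \<open>g\<close> by \<open>t - g\<close>.\<close>

definition qeval :: "int \<times> int \<Rightarrow> 'a :: comm_ring_1 \<Rightarrow> 'a" where
  "qeval z g = of_int (fst z) + of_int (snd z) * g"

definition qmul :: "int \<Rightarrow> int \<Rightarrow> int \<times> int \<Rightarrow> int \<times> int \<Rightarrow> int \<times> int" where
  "qmul t n z w = (fst z * fst w - n * (snd z * snd w),
                   fst z * snd w + snd z * fst w + t * (snd z * snd w))"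

definition qnorm :: "int \<Rightarrow> int \<Rightarrow> int \<times> int \<Rightarrow> int" where
  "qnorm t n z = (fst z)\<^sup>2 + t * (fst z * snd z) + n * (snd z)\<^sup>2"

definition qpow :: "int \<Rightarrow> int \<Rightarrow> int \<times> int \<Rightarrow> nat \<Rightarrow> int \<times> int" where
  "qpow t n z k = (qmul t n z ^^ k) (1, 0)"

lemma qpow_0 [simp]: "qpow t n z 0 = (1, 0)"
  and qpow_Suc [simp]: "qpow t n z (Suc k) = qmul t n z (qpow t n z k)"
  by (simp_all add: qpow_def)

lemma qmul_one [simp]: "qmul t n z (1, 0) = z"
  by (simp add: qmul_def)

text \<open>Keeping the defect term for arbitrary \<open>g\<close> lets one identity serve both the
  exact real or complex roots and the roots modulo \<open>q\<close>.\<close>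

lemma qeval_qmul:
  "qeval z g * qeval w g = qeval (qmul t n z w) g
     + of_int (snd z * snd w) * (g\<^sup>2 - of_int t * g + of_int n)"
  by (simp add: qeval_def qmul_def algebra_simps power2_eq_square)

lemma qeval_conj_mult:
  "qeval z g * qeval z (of_int t - g) = of_int (qnorm t n z)
     - of_int ((snd z)\<^sup>2) * (g\<^sup>2 - of_int t * g + of_int n)"
  by (simp add: qeval_def qnorm_def algebra_simps power2_eq_square)

lemma qnorm_qmul: "qnorm t n (qmul t n z w) = qnorm t n z * qnorm t n w"
  by (simp add: qnorm_def qmul_def algebra_simps power2_eq_square)

lemma qnorm_qpow: "qnorm t n (qpow t n z k) = qnorm t n z ^ k"
proof (induction k)
  case 0 show ?case by (simp add: qnorm_def)
next
  case (Suc k) thus ?case by (simp add: qnorm_qmul)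
qed

lemma qeval_qmul_root:
  assumes "g\<^sup>2 - of_int t * g + of_int n = 0"
  shows "qeval (qmul t n z w) g = qeval z g * qeval w g"
  using qeval_qmul[of z g w t n] assms by simp

lemma qeval_qpow_root:
  assumes "g\<^sup>2 - of_int t * g + of_int n = 0"
  shows "qeval (qpow t n z k) g = qeval z g ^ k"
proof (induction k)
  case 0 show ?case by (simp add: qeval_def)
next
  case (Suc k) thus ?case by (simp add: qeval_qmul_root[OF assms])
qed

lemma qeval_qmul_dvd:
  fixes g q :: int
  assumes "q dvd g\<^sup>2 - t * g + n"
  shows "q dvd qeval (qmul t n z w) g - qeval z g * qeval w g"
proof -
  have "qeval (qmul t n z w) g - qeval z g * qeval w g = - (snd z * snd w) * (g\<^sup>2 - t * g + n)"
    using qeval_qmul[of z g w t n] by simp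
  thus ?thesis using assms by simp
qed

lemma qeval_qpow_dvd:
  fixes g q :: int
  assumes q: "q dvd g\<^sup>2 - t * g + n"
  shows "q dvd qeval (qpow t n z k) g - qeval z g ^ k"
proof (induction k)
  case 0 show ?case by (simp add: qeval_def)
next
  case (Suc k)
  have "qeval (qpow t n z (Suc k)) g - qeval z g ^ Suc k
      = (qeval (qmul t n z (qpow t n z k)) g - qeval z g * qeval (qpow t n z k) g)
        + qeval z g * (qeval (qpow t n z k) g - qeval z g ^ k)"
    by (simp add: algebra_simps)
  thus ?case using Suc qeval_qmul_dvd[OF q, of z "qpow t n z k"] by (metis dvd_add dvd_mult)
qed

lemma qeval_conj_mult_dvd:
  fixes g q :: int
  assumes "q dvd g\<^sup>2 - t * g + n"
  shows "q dvd qeval z g * qeval z (t - g) - qnorm t n z"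
  using qeval_conj_mult[of z g t n] assms by simp

lemma norm_qeval_le_max:
  fixes x :: "'a :: real_normed_field"
  shows "norm (qeval z x) \<le> (1 + norm x) * of_int (max \<bar>fst z\<bar> \<bar>snd z\<bar>)"
proof -
  have "norm (qeval z x) \<le> \<bar>of_int (fst z)\<bar> + \<bar>of_int (snd z)\<bar> * norm x"
    unfolding qeval_def by (rule order_trans[OF norm_triangle_ineq]) (simp add: norm_mult)
  also have "\<dots> \<le> of_int (max \<bar>fst z\<bar> \<bar>snd z\<bar>) + of_int (max \<bar>fst z\<bar> \<bar>snd z\<bar>) * norm x"
    by (intro add_mono mult_right_mono) auto
  finally show ?thesis by (simp add: algebra_simps)
qed

text \<open>With \<open>s\<close> the integer part of the square root of \<open>q\<close>, the box
  holds \<open>(s + 1)^2 > q\<close> pairs, so two of them give the same residue of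
  \<open>x + y * g\<close>; their difference is the required pair.\<close>

lemma Thue_lemma:
  fixes q g :: int
  assumes q: "q > 0"
  obtains x y :: int where "(x, y) \<noteq> (0, 0)" "x\<^sup>2 \<le> q" "y\<^sup>2 \<le> q" "q dvd x + y * g"
proof -
  define s where "s = \<lfloor>sqrt (of_int q)\<rfloor>"
  have s0: "s \<ge> 0" using q by (simp add: s_def)
  have "of_int s \<le> sqrt (of_int q)" by (simp add: s_def)
  hence "(of_int s)\<^sup>2 \<le> (sqrt (of_int q))\<^sup>2" using s0 by (intro power_mono) auto
  hence "(of_int (s\<^sup>2) :: real) \<le> of_int q" using q by simp
  hence s1: "s\<^sup>2 \<le> q" by (simp only: of_int_le_iff)
  have "sqrt (of_int q) < of_int (s + 1)" unfolding s_def by linarith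
  hence "(sqrt (of_int q))\<^sup>2 < (of_int (s + 1))\<^sup>2" using q by (intro power_strict_mono) auto
  hence "(of_int q :: real) < of_int ((s + 1)\<^sup>2)" using q by simp
  hence s2: "q < (s + 1)\<^sup>2" by (simp only: of_int_less_iff)
  define F where "F = (\<lambda>(x, y). (x + y * g) mod q)"
  have "F ` ({0..s} \<times> {0..s}) \<subseteq> {0..<q}" using q by (auto simp: F_def)
  hence "card (F ` ({0..s} \<times> {0..s})) \<le> nat q"
    using card_mono[of "{0..<q}"] by simp
  also have "nat q < card ({0..s} \<times> {0..s})"
    using s2 s0 q by (simp add: card_cartesian_product power2_eq_square nat_mult_distrib[symmetric] add.commute)
  finally have "\<not> inj_on F ({0..s} \<times> {0..s})" by (rule pigeonhole)
  then obtain a b c d where abcd: "a \<in> {0..s}" "b \<in> {0..s}" "c \<in> {0..s}" "d \<in> {0..s}"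
      "(a, b) \<noteq> (c, d)" "F (a, b) = F (c, d)"
    by (auto simp: inj_on_def)
  have sq: "(x - y)\<^sup>2 \<le> q" if "x \<in> {0..s}" "y \<in> {0..s}" for x y
  proof -
    have "\<bar>x - y\<bar>\<^sup>2 \<le> s\<^sup>2" using that by (intro power_mono) auto
    thus ?thesis using s1 by simp
  qed
  show ?thesis
  proof
    show "(a - c, b - d) \<noteq> (0, 0)" using abcd by auto
    show "(a - c)\<^sup>2 \<le> q" "(b - d)\<^sup>2 \<le> q" using abcd sq by auto
    have "q dvd (a + b * g) - (c + d * g)" using abcd(6) by (simp add: F_def mod_eq_dvd_iff)
    thus "q dvd (a - c) + (b - d) * g" by (simp add: algebra_simps)
  qed
qed

text \<open>The sequence \<open>g\<close> presents a p-adic integer \<open>\<gamma>\<close> by its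
  truncations. The condition \<open>unramified\<close> makes the two roots \<open>g i\<close> and
  \<open>t - g i\<close> incongruent modulo \<open>p\<close> for \<open>i >= 1\<close>, and
  \<open>anisotropic\<close> expresses through the norm form that \<open>X^2 - t X + n\<close> has
  no rational root.\<close>

locale padic_quadratic_integer =
  fixes p :: nat and t n :: int and g :: "nat \<Rightarrow> int"
  assumes prime: "prime p"
    and root: "int p ^ i dvd (g i)\<^sup>2 - t * g i + n"
    and coherent: "int p ^ i dvd g (Suc i) - g i"
    and unramified: "\<not> int p dvd t\<^sup>2 - 4 * n"
    and anisotropic: "qnorm t n z = 0 \<Longrightarrow> z = (0, 0)"
begin

lemma prime_int: "prime (int p)" and p_gt_1: "int p > 1"
  using prime prime_gt_1_nat by auto

lemma coherent_le: "i \<le> j \<Longrightarrow> int p ^ i dvd g j - g i"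
  by (rule coherent_dvd_diff[OF coherent])

lemma root_le: "i \<le> j \<Longrightarrow> int p ^ i dvd (g j)\<^sup>2 - t * g j + n"
  using root[of j] by (meson dvd_trans le_imp_power_dvd)

lemma qeval_coherent: "i \<le> j \<Longrightarrow> int p ^ i dvd qeval z (g j) - qeval z (g i)"
  using coherent_le[of i j] by (simp add: qeval_def flip: right_diff_distrib)

lemma qeval_conj_coherent: "i \<le> j \<Longrightarrow> int p ^ i dvd qeval z (t - g j) - qeval z (t - g i)"
proof -
  assume "i \<le> j"
  hence "int p ^ i dvd - (snd z) * (g j - g i)" using coherent_le[of i j] by (intro dvd_mult)
  thus ?thesis by (simp add: qeval_def algebra_simps)
qed

text \<open>Thue's lemma gives \<open>z\<close> with entries of size at most \<open>p^(m/2)\<close>,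
  so its norm is at most a constant times \<open>p^m\<close>, while divisibility at the root
  \<open>g m\<close> forces \<open>p^m\<close> to divide the norm. The point is that the bound for
  the cofactor \<open>c\<close> does not depend on \<open>m\<close>.\<close>

lemma exists_small_norm:
  obtains z c where "c \<noteq> 0" "\<bar>c\<bar> \<le> 1 + \<bar>t\<bar> + \<bar>n\<bar>" "qnorm t n z = int p ^ m * c"
    "int p ^ m dvd qeval z (g m)"
proof -
  define q where "q = int p ^ m"
  have q: "q > 0" using p_gt_1 by (simp add: q_def)
  obtain x y where xy: "(x, y) \<noteq> (0, 0)" "x\<^sup>2 \<le> q" "y\<^sup>2 \<le> q" "q dvd x + y * g m"
    using Thue_lemma[OF q] by blast
  have ev: "q dvd qeval (x, y) (g m)" using xy by (simp add: qeval_def)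
  have "q dvd qnorm t n (x, y)"
    using dvd_diff_imp_dvd_iff[OF qeval_conj_mult_dvd[OF root[of m], of "(x, y)"]] ev
    unfolding q_def by simp
  then obtain c where c: "qnorm t n (x, y) = q * c" by (auto elim: dvdE)
  have c0: "c \<noteq> 0" using anisotropic[of "(x, y)"] xy(1) c by auto
  have "2 * \<bar>x * y\<bar> \<le> x\<^sup>2 + y\<^sup>2"
    using zero_le_power2[of "\<bar>x\<bar> - \<bar>y\<bar>"] by (simp add: power2_diff abs_mult)
  hence xyq: "\<bar>x * y\<bar> \<le> q" using xy by linarith
  have "q * \<bar>c\<bar> = \<bar>x\<^sup>2 + t * (x * y) + n * y\<^sup>2\<bar>"
    using c q by (simp add: qnorm_def abs_mult)
  also have "\<dots> \<le> \<bar>x\<^sup>2\<bar> + \<bar>t\<bar> * \<bar>x * y\<bar> + \<bar>n\<bar> * \<bar>y\<^sup>2\<bar>"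
    unfolding abs_mult[symmetric] by linarith
  also have "\<dots> \<le> q + \<bar>t\<bar> * q + \<bar>n\<bar> * q"
    using xy xyq by (intro add_mono mult_left_mono) auto
  also have "\<dots> = q * (1 + \<bar>t\<bar> + \<bar>n\<bar>)" by (simp add: algebra_simps)
  finally have "\<bar>c\<bar> \<le> 1 + \<bar>t\<bar> + \<bar>n\<bar>" using q by simp
  thus ?thesis using that[of c "(x, y)"] c0 c ev by (simp add: q_def)
qed

text \<open>The witness is \<open>\<rho> = z' / z\<close>. Unramifiedness allows testing divisibility of \<open>z' z\<^sup>*\<close> by powers of \<open>p\<close>
  separately in the two \<open>p\<close>-adic embeddings.\<close>

lemma exists_quotient:
  assumes c: "c = int p ^ e * c'" "\<not> int p dvd c'" "c' \<noteq> 0"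
    and m: "m + e + 1 \<le> m'"
    and z: "qnorm t n z = int p ^ m * c" "int p ^ m dvd qeval z (g m)"
    and z': "qnorm t n z' = int p ^ m' * c" "int p ^ m' dvd qeval z' (g m')"
    and cong: "int p * c dvd fst z' - fst z" "int p * c dvd snd z' - snd z"
  obtains \<rho> where "qnorm t n \<rho> = int p ^ (m' - m)" "int p dvd qeval \<rho> (g 1)"
    "\<not> int p dvd qeval \<rho> (t - g 1)"
proof -
  let ?p = "int p" and ?g = "g m'"
  \<comment> \<open>\<open>zc\<close> is the conjugate of \<open>z\<close>; the product
    \<open>w\<close> will be divided by \<open>p^m * c\<close>, the norm of \<open>z\<close>, to
    give \<open>z' / z\<close>.\<close>
  define zc where "zc = (fst z + t * snd z, - snd z)"
  define w where "w = qmul t n z' zc"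
  have zcg: "qeval zc u = qeval z (t - u)" "qeval zc (t - u) = qeval z u" for u :: int
    by (simp_all add: zc_def qeval_def algebra_simps)
  have Ndef: "qnorm t n z = (fst z)\<^sup>2 + t * (fst z * snd z) + n * (snd z)\<^sup>2" by (simp add: qnorm_def)
  have w1: "fst w = qnorm t n z + (fst z' - fst z) * (fst z + t * snd z) + n * (snd z * (snd z' - snd z))"
    unfolding Ndef by (simp add: w_def qmul_def zc_def algebra_simps power2_eq_square)
  have w2: "snd w = fst z * (snd z' - snd z) - snd z * (fst z' - fst z)"
    by (simp add: w_def qmul_def zc_def algebra_simps)
  \<comment> \<open>As \<open>z'\<close> is congruent to \<open>z\<close> modulo \<open>c\<close>,
    \<open>w\<close> is congruent to the norm of \<open>z\<close>, a multiple of
    \<open>c\<close>.\<close>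
  have "c dvd fst z' - fst z" "c dvd snd z' - snd z"
    using cong by (meson dvd_mult_right)+
  hence cw: "c dvd fst w" "c dvd snd w"
    unfolding w1 w2 z(1) by (auto intro!: dvd_add dvd_diff)
  have rt: "?p ^ m' dvd ?g\<^sup>2 - t * ?g + n" by (rule root)
  have rt': "?p ^ m' dvd (t - ?g)\<^sup>2 - t * (t - ?g) + n"
    using rt by (simp add: algebra_simps power2_eq_square)
  have le: "?p ^ (m + e + 1) dvd ?p ^ m'" using m by (rule le_imp_power_dvd)
  \<comment> \<open>At the first root \<open>z'\<close> alone supplies the factor, because
    \<open>m'\<close> is at least \<open>m + e + 1\<close>; this is one power of \<open>p\<close>
    more than \<open>p^m * c\<close> contains.\<close>
  have A: "?p ^ (m + e + 1) dvd qeval w ?g"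
  proof -
    have "?p ^ m' dvd qeval z' ?g * qeval zc ?g" using z'(2) by simp
    moreover have "?p ^ m' dvd qeval w ?g - qeval z' ?g * qeval zc ?g"
      unfolding w_def by (rule qeval_qmul_dvd[OF rt])
    ultimately have "?p ^ m' dvd qeval w ?g" by (metis diff_add_cancel dvd_add)
    thus ?thesis using le by (rule dvd_trans[rotated])
  qed
  have zg: "?p ^ m dvd qeval z ?g"
    using qeval_coherent[of m m' z] z(2) m by (metis add_leD1 diff_add_cancel dvd_add)
  \<comment> \<open>At the second root \<open>z'\<close> may be replaced by \<open>z\<close> modulo
    \<open>p^(e + 1)\<close> and \<open>zc\<close> contributes \<open>p^m\<close>, so
    \<open>w\<close> agrees with the norm of \<open>z\<close> to one power beyond
    \<open>p^(m + e)\<close>.\<close>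
  have B: "?p ^ (m + e + 1) dvd qeval w (t - ?g) - ?p ^ m * c"
  proof -
    have 1: "?p ^ (m + e + 1) dvd qeval w (t - ?g) - qeval z' (t - ?g) * qeval z ?g"
      using qeval_qmul_dvd[OF rt', of z' zc] le unfolding zcg(2) w_def by (rule dvd_trans[rotated])
    have "?p * c dvd qeval z' (t - ?g) - qeval z (t - ?g)"
    proof -
      have "qeval z' (t - ?g) - qeval z (t - ?g) = (fst z' - fst z) + (snd z' - snd z) * (t - ?g)"
        by (simp add: qeval_def algebra_simps)
      thus ?thesis using cong by simp
    qed
    moreover have "?p ^ (e + 1) dvd ?p * c" by (simp add: c(1))
    ultimately have "?p ^ (e + 1) dvd qeval z' (t - ?g) - qeval z (t - ?g)" by (rule dvd_trans[rotated])
    hence "?p ^ (e + 1) * ?p ^ m dvd (qeval z' (t - ?g) - qeval z (t - ?g)) * qeval z ?g"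
      using zg by (rule mult_dvd_mono)
    hence 2: "?p ^ (m + e + 1) dvd qeval z' (t - ?g) * qeval z ?g - qeval z (t - ?g) * qeval z ?g"
      by (simp add: algebra_simps power_add)
    have 3: "?p ^ (m + e + 1) dvd qeval z (t - ?g) * qeval z ?g - ?p ^ m * c"
      using qeval_conj_mult_dvd[OF rt, of z] le unfolding z(1)
      by (metis dvd_trans mult.commute)
    from dvd_add[OF dvd_add[OF 1 2] 3] show ?thesis by simp
  qed
  \<comment> \<open>The two roots differ by a p-adic unit: the square of their difference is the
    discriminant modulo \<open>p\<close>.\<close>
  have unit: "\<not> ?p dvd t - 2 * ?g"
  proof
    assume "?p dvd t - 2 * ?g"
    hence "?p dvd (t - 2 * ?g)\<^sup>2" by (simp add: power2_eq_square)
    moreover have "?p dvd 4 * (?g\<^sup>2 - t * ?g + n)"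
      using root_le[of 1 m'] m by (intro dvd_mult) simp
    ultimately have "?p dvd (t - 2 * ?g)\<^sup>2 - 4 * (?g\<^sup>2 - t * ?g + n)" by (rule dvd_diff)
    also have "(t - 2 * ?g)\<^sup>2 - 4 * (?g\<^sup>2 - t * ?g + n) = t\<^sup>2 - 4 * n"
      by (simp add: algebra_simps power2_eq_square)
    finally show False using unramified by simp
  qed
  have A': "?p ^ (m + e) dvd qeval w ?g" using A by (simp add: dvd_mult_right)
  have "?p ^ (m + e) dvd qeval w (t - ?g) - ?p ^ m * c" using B by (simp add: dvd_mult_right)
  moreover have "?p ^ (m + e) dvd ?p ^ m * c" by (simp add: c(1) power_add)
  ultimately have B': "?p ^ (m + e) dvd qeval w (t - ?g)" by (metis diff_add_cancel dvd_add)
  \<comment> \<open>Subtracting the two embeddings isolates \<open>snd w\<close> up to that unit, so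
    divisibility at both roots descends to the coefficients.\<close>
  have "?p ^ (m + e) dvd qeval w (t - ?g) - qeval w ?g" using A' B' by (rule dvd_diff[rotated])
  hence "?p ^ (m + e) dvd snd w * (t - 2 * ?g)" by (simp add: qeval_def algebra_simps)
  moreover have "coprime (?p ^ (m + e)) (t - 2 * ?g)"
    using unit prime_int by (simp add: prime_imp_coprime coprime_power_left_iff)
  ultimately have pw2: "?p ^ (m + e) dvd snd w" by (simp add: coprime_dvd_mult_left_iff)
  have "fst w = qeval w ?g - snd w * ?g" by (simp add: qeval_def)
  hence pw1: "?p ^ (m + e) dvd fst w" using A' pw2 by simp
  have cop: "coprime (?p ^ (m + e)) c'"
    using c(2) prime_int by (simp add: prime_imp_coprime coprime_power_left_iff)
  have pmc: "?p ^ m * c = ?p ^ (m + e) * c'" by (simp add: c(1) power_add)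
  have c'w: "c' dvd fst w" "c' dvd snd w" using cw c(1) by (meson dvd_mult_right)+
  have "?p ^ m * c dvd fst w" "?p ^ m * c dvd snd w"
    unfolding pmc using pw1 pw2 c'w cop by (auto intro: divides_mult)
  then obtain X Y where XY: "fst w = ?p ^ m * c * X" "snd w = ?p ^ m * c * Y"
    by (meson dvdE)
  have pm0: "?p ^ m * c \<noteq> 0" using c p_gt_1 by auto
  define \<rho> where "\<rho> = (X, Y)"
  have ev: "qeval w u = ?p ^ m * c * qeval \<rho> u" for u :: int
    by (simp add: qeval_def XY \<rho>_def algebra_simps)
  have "(?p ^ m * c)\<^sup>2 * qnorm t n \<rho> = qnorm t n w"
    by (simp add: qnorm_def XY \<rho>_def algebra_simps power2_eq_square)
  also have "\<dots> = qnorm t n z' * qnorm t n zc" unfolding w_def by (rule qnorm_qmul)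
  also have "qnorm t n zc = qnorm t n z" by (simp add: zc_def qnorm_def algebra_simps power2_eq_square)
  also have "qnorm t n z' * qnorm t n z = (?p ^ m * c)\<^sup>2 * ?p ^ (m' - m)"
  proof -
    have "?p ^ m' = ?p ^ m * ?p ^ (m' - m)" using m by (simp flip: power_add)
    thus ?thesis unfolding z z' by (simp add: power2_eq_square)
  qed
  finally have N: "qnorm t n \<rho> = ?p ^ (m' - m)" using pm0 p_gt_1 by simp
  have split: "?p ^ (m + e + 1) = (?p ^ (m + e)) * ?p" by simp
  have pme: "?p ^ (m + e) \<noteq> 0" using p_gt_1 by simp
  have copc: "coprime ?p c'" using c(2) prime_int by (simp add: prime_imp_coprime)
  \<comment> \<open>After cancelling \<open>p^(m + e)\<close>, the spare power of \<open>p\<close>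
    in \<open>A\<close> and \<open>B\<close> shows that modulo \<open>p\<close> the quotient
    \<open>\<rho>\<close> is 0 at the first root and 1 at the second.\<close>
  have "?p ^ (m + e) * ?p dvd ?p ^ (m + e) * (c' * qeval \<rho> ?g)"
    using A unfolding ev pmc split by (simp only: mult.assoc)
  hence "?p dvd c' * qeval \<rho> ?g" using pme p_gt_1 by simp
  hence C: "?p dvd qeval \<rho> ?g" using copc by (simp add: coprime_dvd_mult_right_iff)
  have "?p ^ (m + e) * ?p dvd ?p ^ (m + e) * (c' * (qeval \<rho> (t - ?g) - 1))"
    using B unfolding ev pmc split by (simp only: mult.assoc right_diff_distrib mult_1_right)
  hence "?p dvd c' * (qeval \<rho> (t - ?g) - 1)" using pme p_gt_1 by simp
  hence E: "?p dvd qeval \<rho> (t - ?g) - 1" using copc by (simp add: coprime_dvd_mult_right_iff)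
  have m1: "1 \<le> m'" using m by simp
  have C1: "?p dvd qeval \<rho> (g 1)"
    using dvd_diff_imp_dvd_iff[OF qeval_coherent[OF m1, of \<rho>]] C by simp
  have E1: "?p dvd qeval \<rho> (t - g 1) - 1"
    using dvd_diff[OF E qeval_conj_coherent[OF m1, of \<rho>, simplified]] by simp
  have "\<not> ?p dvd qeval \<rho> (t - g 1)"
  proof
    assume "?p dvd qeval \<rho> (t - g 1)"
    from dvd_diff[OF this E1] have "?p dvd 1" by simp
    thus False using p_gt_1 by simp
  qed
  thus ?thesis using that N C1 by blast
qed

text \<open>Each \<open>m\<close> yields a cofactor \<open>c\<close> and two coefficients modulo
  \<open>p * c\<close>, a triple from a finite set. Two exponents with the same triple, far enough
  apart to absorb the power of \<open>p\<close> in \<open>c\<close>, meet the hypotheses of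
  \<open>exists_quotient\<close>.\<close>

lemma exists_uniformizer:
  obtains \<rho> h where "h \<ge> 1" "qnorm t n \<rho> = int p ^ h" "int p dvd qeval \<rho> (g 1)"
    "\<not> int p dvd qeval \<rho> (t - g 1)"
proof -
  define K where "K = 1 + \<bar>t\<bar> + \<bar>n\<bar>"
  have "\<forall>m. \<exists>zc. snd zc \<noteq> 0 \<and> \<bar>snd zc\<bar> \<le> K \<and> qnorm t n (fst zc) = int p ^ m * snd zc
      \<and> int p ^ m dvd qeval (fst zc) (g m)"
    using exists_small_norm unfolding K_def by (metis fst_conv snd_conv)
  then obtain zc where zc: "\<And>m. snd (zc m) \<noteq> 0" "\<And>m. \<bar>snd (zc m)\<bar> \<le> K"
      "\<And>m. qnorm t n (fst (zc m)) = int p ^ m * snd (zc m)"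
      "\<And>m. int p ^ m dvd qeval (fst (zc m)) (g m)"
    by metis
  define F where "F = (\<lambda>m. (snd (zc m), fst (fst (zc m)) mod (int p * snd (zc m)),
      snd (fst (zc m)) mod (int p * snd (zc m))))"
  let ?L = "int p * K"
  have mb: "x mod (int p * snd (zc m)) \<in> {-?L..?L}" for x m
  proof -
    have "\<bar>x mod (int p * snd (zc m))\<bar> < \<bar>int p * snd (zc m)\<bar>"
      using zc(1)[of m] p_gt_1 by (intro abs_mod_less) auto
    also have "\<dots> \<le> ?L" using zc(2)[of m] p_gt_1 by (simp add: abs_mult)
    finally show ?thesis by auto
  qed
  have "range F \<subseteq> {-K..K} \<times> {-?L..?L} \<times> {-?L..?L}"
  proof
    fix v assume "v \<in> range F"
    then obtain m where m: "v = F m" by blast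
    have "snd (zc m) \<in> {-K..K}" using zc(2)[of m] by auto
    thus "v \<in> {-K..K} \<times> {-?L..?L} \<times> {-?L..?L}" using mb unfolding m F_def by blast
  qed
  hence "finite (range F)" by (rule finite_subset) auto
  from pigeonhole_infinite[OF infinite_UNIV_nat this] obtain m where m: "infinite {a. F a = F m}"
    by auto
  define c where "c = snd (zc m)"
  have c0: "c \<noteq> 0" using zc by (simp add: c_def)
  obtain c' where c': "c = int p ^ multiplicity (int p) c * c'" "\<not> int p dvd c'"
    using multiplicity_decompose'[of c "int p"] c0 p_gt_1 by auto
  obtain m' where m': "m + multiplicity (int p) c + 1 \<le> m'" "F m' = F m"
    using m unfolding infinite_nat_iff_unbounded_le by blast
  have cm': "snd (zc m') = c"
    and cong: "int p * c dvd fst (fst (zc m')) - fst (fst (zc m))"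
      "int p * c dvd snd (fst (zc m')) - snd (fst (zc m))"
    using m'(2) by (auto simp: F_def c_def mod_eq_dvd_iff)
  have "c' \<noteq> 0" using c' c0 by auto
  obtain \<rho> where "qnorm t n \<rho> = int p ^ (m' - m)" "int p dvd qeval \<rho> (g 1)"
    "\<not> int p dvd qeval \<rho> (t - g 1)"
    by (rule exists_quotient[OF c' \<open>c' \<noteq> 0\<close> m'(1) _ zc(4)[of m] _ zc(4)[of m'] cong])
      (use zc(3)[of m] zc(3)[of m'] cm' in \<open>auto simp: c_def\<close>)
  thus ?thesis using that[of "m' - m"] m'(1) by simp
qed

text \<open>Since the conjugate of \<open>\<rho>\<close> is a unit at \<open>p\<close>, all of the
  norm \<open>p^h\<close> divides \<open>\<rho>\<close> itself in the first embedding. Powers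
  follow, and a further factor \<open>\<eta>\<close> does no harm.\<close>

lemma uniformizer_qpow_dvd:
  assumes \<rho>: "qnorm t n \<rho> = int p ^ h" "\<not> int p dvd qeval \<rho> (t - g 1)" and k: "k \<ge> 1"
  shows "int p ^ (h * k) dvd qeval (qmul t n (qpow t n \<rho> k) \<eta>) (g (h * k))"
proof (cases "h = 0")
  case False
  let ?g = "g (h * k)"
  have hk: "1 \<le> h * k" "h \<le> h * k" using False k by auto
  have "\<not> int p dvd qeval \<rho> (t - ?g)"
    using dvd_diff_imp_dvd_iff[OF qeval_conj_coherent[OF hk(1), of \<rho>]] \<rho>(2) by simp
  hence cop: "coprime (int p ^ h) (qeval \<rho> (t - ?g))"
    using prime_int by (simp add: prime_imp_coprime coprime_power_left_iff)
  have "int p ^ h dvd qeval \<rho> ?g * qeval \<rho> (t - ?g) - int p ^ h"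
    using qeval_conj_mult_dvd[OF root_le[OF hk(2)], of \<rho>] \<rho>(1) by simp
  hence "int p ^ h dvd qeval \<rho> ?g * qeval \<rho> (t - ?g)" by (metis diff_add_cancel dvd_add dvd_refl)
  hence "int p ^ h dvd qeval \<rho> ?g" using cop by (simp add: coprime_dvd_mult_left_iff)
  hence 1: "int p ^ (h * k) dvd qeval \<rho> ?g ^ k" unfolding power_mult by (rule dvd_power_same)
  have "int p ^ (h * k) dvd qeval (qpow t n \<rho> k) ?g"
    using qeval_qpow_dvd[OF root[of "h * k"], of \<rho> k] 1 by (metis diff_add_cancel dvd_add)
  hence "int p ^ (h * k) dvd qeval (qpow t n \<rho> k) ?g * qeval \<eta> ?g" by simp
  with qeval_qmul_dvd[OF root[of "h * k"], of "qpow t n \<rho> k" \<eta>] show ?thesis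
    by (metis diff_add_cancel dvd_add)
qed simp

text \<open>A rational integer takes the same value in both p-adic embeddings, but \<open>p\<close>
  divides the first value and, since \<open>\<rho>\<close> and \<open>\<eta>\<close> are units at
  the second root, not the second. This is the source of irrationality for imaginary and real
  \<open>\<gamma>\<close> alike.\<close>

lemma uniformizer_qpow_not_integer:
  assumes \<rho>: "int p dvd qeval \<rho> (g 1)" "\<not> int p dvd qeval \<rho> (t - g 1)"
    and \<eta>: "qnorm t n \<eta> = 1" and k: "k \<ge> 1"
  shows "snd (qmul t n (qpow t n \<rho> k) \<eta>) \<noteq> 0"
proof
  let ?w = "qmul t n (qpow t n \<rho> k) \<eta>" and ?p = "int p"
  assume "snd ?w = 0"
  hence w: "qeval ?w u = fst ?w" for u :: int by (simp add: qeval_def)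
  have r1: "?p dvd (g 1)\<^sup>2 - t * g 1 + n" using root[of 1] by simp
  have r2: "?p dvd (t - g 1)\<^sup>2 - t * (t - g 1) + n"
    using r1 by (simp add: algebra_simps power2_eq_square)
  have main: "?p dvd qeval \<rho> u ^ k * qeval \<eta> u - fst ?w"
    if "?p dvd u\<^sup>2 - t * u + n" for u
  proof -
    have "qeval \<rho> u ^ k * qeval \<eta> u - fst ?w
        = - ((qeval (qpow t n \<rho> k) u - qeval \<rho> u ^ k) * qeval \<eta> u)
          - (qeval ?w u - qeval (qpow t n \<rho> k) u * qeval \<eta> u)"
      unfolding w by (simp add: algebra_simps)
    thus ?thesis using qeval_qmul_dvd[OF that, of "qpow t n \<rho> k" \<eta>] qeval_qpow_dvd[OF that, of \<rho> k]
      by (metis dvd_diff dvd_minus_iff dvd_mult2)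
  qed
  have "?p dvd qeval \<rho> (g 1) ^ k * qeval \<eta> (g 1)"
    using \<rho>(1) k by (intro dvd_mult2) (simp add: dvd_power_le[of _ _ 1 k, simplified])
  hence "?p dvd fst ?w" using dvd_diff_imp_dvd_iff[OF main[OF r1]] by simp
  hence "?p dvd qeval \<rho> (t - g 1) ^ k * qeval \<eta> (t - g 1)" using main[OF r2] by (metis diff_add_cancel dvd_add)
  hence "?p dvd qeval \<eta> (t - g 1)"
    using \<rho>(2) prime_int by (metis prime_dvd_mult_iff prime_dvd_power)
  hence "?p dvd qeval \<eta> (g 1) * qeval \<eta> (t - g 1)" by simp
  moreover have "?p dvd qeval \<eta> (g 1) * qeval \<eta> (t - g 1) - 1"
    using qeval_conj_mult_dvd[OF r1, of \<eta>] \<eta> by simp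
  ultimately have "?p dvd 1" using dvd_diff_imp_dvd_iff by blast
  thus False using p_gt_1 by simp
qed

end

section \<open>Good simultaneous approximations\<close>

text \<open>\<open>W u v w\<close> is to be read as \<open>|u \<beta> - v|\<^sub>p \<le> w\<close>. Separating the \<open>p\<close>-adic bound from the real one makes the
  notion stable under integral linear changes of \<open>(u, v)\<close>; multiplying the two bounds gives the theorem.\<close>

definition good_approx :: "(int \<Rightarrow> int \<Rightarrow> real \<Rightarrow> bool) \<Rightarrow> real \<Rightarrow> bool" where
  "good_approx W a \<longleftrightarrow> (\<exists>C>0. \<forall>N :: nat. \<exists>u v w.
     int N \<le> max \<bar>u\<bar> \<bar>v\<bar> \<and> W u v w \<and> (of_int (max \<bar>u\<bar> \<bar>v\<bar>))\<^sup>2 * w \<le> C \<and>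
     \<bar>of_int u * a - of_int v\<bar> * ln (of_int (max \<bar>u\<bar> \<bar>v\<bar>)) \<le> C * of_int (max \<bar>u\<bar> \<bar>v\<bar>))"

text \<open>The \<open>p\<close>-adic number is the limit of the integers \<open>g m\<close>, and \<open>g m\<close> is correct modulo \<open>p\<^sup>m\<close>.\<close>

definition padic_dist_le :: "nat \<Rightarrow> (nat \<Rightarrow> int) \<Rightarrow> int \<Rightarrow> int \<Rightarrow> real \<Rightarrow> bool" where
  "padic_dist_le p g u v w \<longleftrightarrow> (\<exists>m. w = 1 / real p ^ m \<and> int p ^ m dvd u * g m - v)"

lemma abs_exp_diff_le:
  fixes x y :: real
  assumes "x \<le> Y" "y \<le> Y"
  shows "\<bar>exp x - exp y\<bar> \<le> exp Y * \<bar>x - y\<bar>"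
proof -
  have *: "exp x - exp y \<le> exp Y * \<bar>x - y\<bar>" if "x \<le> Y" for x y :: real
  proof -
    have "1 - exp (y - x) \<le> \<bar>x - y\<bar>" using exp_ge_add_one_self[of "y - x"] by linarith
    hence "exp x * (1 - exp (y - x)) \<le> exp x * \<bar>x - y\<bar>" by (intro mult_left_mono) auto
    also have "\<dots> \<le> exp Y * \<bar>x - y\<bar>" using that by (intro mult_right_mono) auto
    also have "exp x * (1 - exp (y - x)) = exp x - exp y"
      by (simp add: right_diff_distrib flip: exp_add)
    finally show ?thesis .
  qed
  show ?thesis using *[of x y] *[of y x] assms by (simp add: abs_le_iff abs_minus_commute)
qed

section \<open>Good approximations for an unramified quadratic integer\<close>

context padic_quadratic_integer
begin

text \<open>The element with coefficients \<open>z\<close> corresponds to the pair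
  \<open>(snd z, - fst z)\<close>. Its height is comparable to \<open>r^k\<close>, hence the
  logarithm of the height is at most a constant times \<open>k\<close>, and a real error of order
  \<open>r^k / k\<close> is what \<open>good_approx\<close> asks for. The p-adic bound is
  \<open>1 / (r^k)^2\<close>.\<close>

lemma good_approxI:
  assumes r: "r > 1" "r\<^sup>2 = real p ^ h" and K: "K > 0"
    and ex: "\<And>N. \<exists>k z. k > N \<and> int p ^ (h * k) dvd qeval z (g (h * k)) \<and>
      \<bar>of_int (fst z)\<bar> \<le> K * r ^ k \<and> \<bar>of_int (snd z)\<bar> \<le> K * r ^ k \<and>
      r ^ k \<le> K * of_int (max \<bar>fst z\<bar> \<bar>snd z\<bar>) \<and> \<bar>qeval z a\<bar> \<le> K * r ^ k / real k"
  shows "good_approx (padic_dist_le p g) a"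
proof -
  define L where "L = \<bar>ln K\<bar> + ln r"
  have L: "L > 0" using r by (simp add: L_def add_nonneg_pos)
  define C where "C = K\<^sup>2 + K\<^sup>2 * L"
  have C: "C > 0" using K L by (simp add: C_def add_pos_pos)
  show ?thesis unfolding good_approx_def
  proof (intro exI[of _ C] conjI allI C)
    fix N :: nat
    \<comment> \<open>Every \<open>k > k0\<close> gives height above \<open>N\<close>, because
      \<open>r^k\<close> is at most \<open>K\<close> times the height.\<close>
    obtain k0 where k0: "K * real N < r ^ k0" using real_arch_pow[OF r(1)] by blast
    obtain k z where k: "k > k0" and dv: "int p ^ (h * k) dvd qeval z (g (h * k))"
      and z1: "\<bar>of_int (fst z)\<bar> \<le> K * r ^ k" and z2: "\<bar>of_int (snd z)\<bar> \<le> K * r ^ k"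
      and lo: "r ^ k \<le> K * of_int (max \<bar>fst z\<bar> \<bar>snd z\<bar>)"
      and ap: "\<bar>qeval z a\<bar> \<le> K * r ^ k / real k"
      using ex by blast
    define M where "M = (of_int (max \<bar>snd z\<bar> \<bar>- fst z\<bar>) :: real)"
    have lo': "r ^ k \<le> K * M" using lo by (simp add: M_def max.commute)
    have hi: "M \<le> K * r ^ k" using z1 z2 by (simp add: M_def)
    have "r ^ k0 \<le> r ^ k" using r k by (intro power_increasing) auto
    hence "K * real N < K * M" using k0 lo' by linarith
    hence NM: "real N < M" using K by simp
    hence M0: "M > 0" by linarith
    have k1: "real k \<ge> 1" using k by simp
    have rk: "r ^ k > 0" using r by simp
    have "ln M \<le> ln (K * r ^ k)" using hi M0 K rk by simp
    also have "\<dots> = ln K + real k * ln r" using K r by (simp add: ln_mult ln_realpow)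
    also have "\<dots> \<le> real k * \<bar>ln K\<bar> + real k * ln r"
      using mult_right_mono[OF k1, of "\<bar>ln K\<bar>"] by linarith
    finally have lnM: "ln M \<le> real k * L" by (simp add: L_def algebra_simps)
    have "\<bar>qeval z a\<bar> * ln M \<le> \<bar>qeval z a\<bar> * (real k * L)"
      using lnM by (intro mult_left_mono) auto
    also have "\<dots> \<le> K * r ^ k / real k * (real k * L)"
      using ap k1 L by (intro mult_right_mono) auto
    also have "\<dots> = K * L * r ^ k" using k1 by simp
    also have "\<dots> \<le> K * L * (K * M)" using lo' K L by (intro mult_left_mono) auto
    also have "\<dots> = K\<^sup>2 * L * M" by (simp add: power2_eq_square)
    also have "\<dots> \<le> C * M" using M0 by (intro mult_right_mono) (auto simp: C_def)
    finally have 1: "\<bar>qeval z a\<bar> * ln M \<le> C * M" .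
    have pk: "real p ^ (h * k) = (r ^ k)\<^sup>2"
      unfolding power_mult r(2)[symmetric] by (simp add: power_mult[symmetric] mult.commute)
    have "M\<^sup>2 \<le> (K * r ^ k)\<^sup>2" using hi M0 by (intro power_mono) auto
    hence "M\<^sup>2 * (1 / real p ^ (h * k)) \<le> K\<^sup>2"
      unfolding pk using rk by (simp add: divide_le_eq power_mult_distrib)
    also have "\<dots> \<le> C" using L by (simp add: C_def)
    finally have 2: "M\<^sup>2 * (1 / real p ^ (h * k)) \<le> C" .
    have 3: "padic_dist_le p g (snd z) (- fst z) (1 / real p ^ (h * k))"
      unfolding padic_dist_le_def using dv by (intro exI[of _ "h * k"]) (simp add: qeval_def algebra_simps)
    have 4: "\<bar>of_int (snd z) * a - of_int (- fst z)\<bar> = \<bar>qeval z a\<bar>"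
      by (simp add: qeval_def algebra_simps)
    have 5: "int N \<le> max \<bar>snd z\<bar> \<bar>- fst z\<bar>" using NM unfolding M_def by linarith
    show "\<exists>u v w. int N \<le> max \<bar>u\<bar> \<bar>v\<bar> \<and> padic_dist_le p g u v w \<and>
        (of_int (max \<bar>u\<bar> \<bar>v\<bar>))\<^sup>2 * w \<le> C \<and>
        \<bar>of_int u * a - of_int v\<bar> * ln (of_int (max \<bar>u\<bar> \<bar>v\<bar>)) \<le> C * of_int (max \<bar>u\<bar> \<bar>v\<bar>)"
      using 1 2 3 5 unfolding 4[symmetric] M_def by blast
  qed
qed

text \<open>The modulus of \<open>\<rho>^k\<close> is exactly \<open>r^k\<close>, so only its
  argument matters: evaluation at \<open>a\<close> is a real linear form on the complex plane, small
  when the argument is close to the direction of the kernel.\<close>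

lemma good_approx_imaginary:
  assumes D: "t\<^sup>2 - 4 * n < 0"
  shows "good_approx (padic_dist_le p g) a"
proof -
  obtain \<rho> h where h: "h \<ge> 1" and \<rho>: "qnorm t n \<rho> = int p ^ h" "int p dvd qeval \<rho> (g 1)"
    "\<not> int p dvd qeval \<rho> (t - g 1)"
    using exists_uniformizer by blast
  define s where "s = sqrt (of_int (4 * n - t\<^sup>2)) / 2"
  have "(of_int (4 * n - t\<^sup>2) :: real) > 0" using D by (subst of_int_0_less_iff) simp
  hence s: "s > 0" "4 * s\<^sup>2 = of_int (4 * n - t\<^sup>2)"
    unfolding s_def power_divide by (simp_all del: of_int_diff)
  define c where "c = Complex (of_int t / 2) s"
  have croot: "c\<^sup>2 - of_int t * c + of_int n = 0"
    using s(2) by (simp add: complex_eq_iff c_def power2_eq_square algebra_simps)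
  have cc: "cnj c = of_int t - c" by (simp add: complex_eq_iff c_def)
  have cn: "cnj (qeval z c) = qeval z (of_int t - c)" for z
    by (simp add: qeval_def cc)
  define \<xi> where "\<xi> = qeval \<rho> c"
  define r where "r = cmod \<xi>"
  have "complex_of_real (r\<^sup>2) = \<xi> * cnj \<xi>" unfolding r_def by (rule complex_norm_square)
  also have "\<dots> = of_int (qnorm t n \<rho>)"
    using qeval_conj_mult[of \<rho> c t n] croot unfolding \<xi>_def cn by simp
  also have "\<dots> = complex_of_real (real p ^ h)" by (simp add: \<rho>)
  finally have r2: "r\<^sup>2 = real p ^ h" by (simp only: of_real_eq_iff)
  have "real p ^ h > 1" using prime prime_gt_1_nat[of p] h by (intro one_less_power) auto
  hence r1: "r > 1" unfolding r2[symmetric]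
    by (metis r_def norm_ge_zero one_power2 power_less_imp_less_base)
  define \<phi> where "\<phi> = Arg \<xi>"
  have pw: "qeval (qpow t n \<rho> k) c = rcis (r ^ k) (real k * \<phi>)" for k
  proof -
    have "qeval (qpow t n \<rho> k) c = \<xi> ^ k" unfolding \<xi>_def by (rule qeval_qpow_root[OF croot])
    also have "\<xi> = rcis r \<phi>" by (simp add: r_def \<phi>_def rcis_cmod_Arg)
    finally show ?thesis by (simp add: DeMoivre2)
  qed
  have sndIm: "of_int (snd z) * s = Im (qeval z c)" for z
    by (simp add: qeval_def c_def)
  \<comment> \<open>If \<open>\<phi> / pi\<close> were rational, some positive power of
    \<open>\<rho>\<close> would be real, hence a rational integer.\<close>
  have irr: "\<phi> / pi \<notin> \<rat>"
  proof
    assume "\<phi> / pi \<in> \<rat>"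
    then obtain x y :: int where xy: "\<phi> / pi = of_int x / of_int y" "y > 0" by (meson Rats_cases')
    have "real (nat y) * \<phi> = of_int x * pi" using xy by (simp add: field_simps)
    hence "of_int (snd (qpow t n \<rho> (nat y))) * s = 0"
      unfolding sndIm pw using sin_zero_iff_int2[of "of_int x * pi"] by auto
    hence "snd (qpow t n \<rho> (nat y)) = 0" using s by simp
    moreover have "snd (qmul t n (qpow t n \<rho> (nat y)) (1, 0)) \<noteq> 0"
      using xy(2) by (intro uniformizer_qpow_not_integer \<rho>) (auto simp: qnorm_def)
    ultimately show False by simp
  qed
  \<comment> \<open>Evaluation at \<open>a\<close> equals the real part plus \<open>\<kappa>\<close>
    times the imaginary part of \<open>qeval z c\<close>; the polar form of
    \<open>\<kappa> + i\<close> turns this into a single sine.\<close>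
  define \<kappa> where "\<kappa> = (a - of_int t / 2) / s"
  define R \<psi> where "R = cmod (Complex \<kappa> 1)" and "\<psi> = Arg (Complex \<kappa> 1)"
  have R\<psi>: "R * cos \<psi> = \<kappa>" "R * sin \<psi> = 1"
    using rcis_cmod_Arg[of "Complex \<kappa> 1"] unfolding R_def[symmetric] \<psi>_def[symmetric]
    by (simp_all add: complex_eq_iff)
  have R0: "R \<ge> 0" by (simp add: R_def)
  have val: "qeval (qpow t n \<rho> k) a = r ^ k * (R * sin (real k * \<phi> + \<psi>))" for k
  proof -
    let ?z = "qpow t n \<rho> k"
    have "of_int (snd ?z) * s = r ^ k * sin (real k * \<phi>)" unfolding sndIm pw by simp
    moreover have "of_int (fst ?z) + of_int (snd ?z) * (of_int t / 2) = Re (qeval ?z c)"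
      by (simp add: qeval_def c_def)
    hence "of_int (fst ?z) + of_int (snd ?z) * (of_int t / 2) = r ^ k * cos (real k * \<phi>)"
      unfolding pw by simp
    moreover have "qeval ?z a = (of_int (fst ?z) + of_int (snd ?z) * (of_int t / 2))
        + \<kappa> * (of_int (snd ?z) * s)"
    proof -
      have \<kappa>s: "\<kappa> * s = a - of_int t / 2" using s by (simp add: \<kappa>_def)
      have "\<kappa> * (of_int (snd ?z) * s) = of_int (snd ?z) * (\<kappa> * s)" by simp
      thus ?thesis unfolding \<kappa>s by (simp add: qeval_def right_diff_distrib)
    qed
    ultimately have "qeval ?z a = r ^ k * (1 * cos (real k * \<phi>) + \<kappa> * sin (real k * \<phi>))"
      by (simp add: algebra_simps)
    also have "\<dots> = r ^ k * (R * sin (real k * \<phi> + \<psi>))"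
      unfolding R\<psi>[symmetric] sin_add by (simp add: algebra_simps)
    finally show ?thesis .
  qed
  \<comment> \<open>The sum of the constants in the four bounds below, so that each of them is at
    most \<open>K\<close>.\<close>
  define K where "K = 1 / s + (1 + cmod c / s) + (1 + cmod c) + R * (6 * pi)"
  have Kparts: "1 / s \<ge> 0" "cmod c / s \<ge> 0" "R * (6 * pi) \<ge> 0" using s R0 by auto
  have K0: "K > 0" using Kparts unfolding K_def by (smt (verit) norm_ge_zero)
  show ?thesis
  proof (rule good_approxI[OF r1 r2 K0])
    fix N
    \<comment> \<open>With target \<open>- \<psi> / pi\<close> the angle
      \<open>k * \<phi> + \<psi>\<close> comes within \<open>6 * pi / k\<close> of a multiple of
      \<open>pi\<close>.\<close>
    obtain k l where k: "k > N" and kl: "\<bar>real k * (\<phi> / pi) - of_int l - (- \<psi> / pi)\<bar> \<le> 6 / real k"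
      using inhomogeneous_approx[OF irr] by blast
    define z where "z = qpow t n \<rho> k"
    have rk: "r ^ k > 0" using r1 by simp
    have nz: "cmod (qeval z c) = r ^ k" unfolding z_def pw using rk by simp
    have bd: "x * r ^ k \<le> K * r ^ k" if "x \<le> K" for x
      using that rk by (intro mult_right_mono) auto
    have "\<bar>of_int (snd z)\<bar> * s = \<bar>Im (qeval z c)\<bar>" using s by (simp add: abs_mult flip: sndIm)
    also have "\<dots> \<le> r ^ k" using abs_Im_le_cmod nz by metis
    finally have sz: "\<bar>of_int (snd z)\<bar> \<le> 1 / s * r ^ k" using s by (simp add: field_simps)
    have "of_int (fst z) = qeval z c - of_int (snd z) * c" by (simp add: qeval_def)
    hence "cmod (of_int (fst z)) \<le> cmod (qeval z c) + cmod (of_int (snd z) * c)"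
      by (metis norm_triangle_ineq4)
    also have "\<dots> = r ^ k + \<bar>of_int (snd z)\<bar> * cmod c" by (simp add: nz norm_mult)
    also have "\<dots> \<le> r ^ k + 1 / s * r ^ k * cmod c" using sz by (intro add_mono mult_right_mono) auto
    finally have fz: "\<bar>of_int (fst z)\<bar> \<le> (1 + cmod c / s) * r ^ k" by (simp add: algebra_simps)
    have lo: "r ^ k \<le> (1 + cmod c) * of_int (max \<bar>fst z\<bar> \<bar>snd z\<bar>)"
      using norm_qeval_le_max[of z c] nz by simp
    have "real k * \<phi> + \<psi> - of_int l * pi = (real k * (\<phi> / pi) - of_int l - (- \<psi> / pi)) * pi"
      by (simp add: field_simps)
    hence "\<bar>real k * \<phi> + \<psi> - of_int l * pi\<bar> = \<bar>real k * (\<phi> / pi) - of_int l - (- \<psi> / pi)\<bar> * pi"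
      by (simp add: abs_mult)
    also have "\<dots> \<le> 6 / real k * pi" using kl by (intro mult_right_mono) auto
    finally have "\<bar>real k * \<phi> + \<psi> - of_int l * pi\<bar> \<le> 6 * pi / real k" by simp
    moreover have "\<bar>sin (real k * \<phi> + \<psi>)\<bar> = \<bar>sin (real k * \<phi> + \<psi> - of_int l * pi)\<bar>"
    proof -
      have l0: "sin (of_int l * pi) = 0" using sin_zero_iff_int2 by blast
      have l1: "\<bar>cos (of_int l * pi)\<bar> = 1"
        using sin_cos_squared_add[of "of_int l * pi"] l0 by (simp add: abs_square_eq_1)
      show ?thesis unfolding sin_diff l0 by (simp add: abs_mult l1)
    qed
    ultimately have "\<bar>sin (real k * \<phi> + \<psi>)\<bar> \<le> 6 * pi / real k"
      using abs_sin_x_le_abs_x by (metis order_trans)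
    hence "r ^ k * (R * \<bar>sin (real k * \<phi> + \<psi>)\<bar>) \<le> r ^ k * (R * (6 * pi / real k))"
      using rk R0 by (intro mult_left_mono) auto
    hence ap: "\<bar>qeval z a\<bar> \<le> R * (6 * pi) * r ^ k / real k"
      unfolding z_def val using rk R0 by (simp add: abs_mult mult_ac)
    have "\<bar>of_int (fst z)\<bar> \<le> K * r ^ k"
      using Kparts by (intro order_trans[OF fz] bd) (simp add: K_def)
    moreover have "\<bar>of_int (snd z)\<bar> \<le> K * r ^ k"
      using Kparts by (intro order_trans[OF sz] bd) (simp add: K_def)
    moreover have "r ^ k \<le> K * of_int (max \<bar>fst z\<bar> \<bar>snd z\<bar>)"
      using Kparts by (intro order_trans[OF lo] mult_right_mono) (auto simp: K_def)
    moreover have "\<bar>qeval z a\<bar> \<le> K * r ^ k / real k"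
      using Kparts by (intro order_trans[OF ap] divide_right_mono bd) (auto simp: K_def)
    moreover have "int p ^ (h * k) dvd qeval z (g (h * k))"
      using uniformizer_qpow_dvd[OF \<rho>(1,3), of k "(1, 0)"] k by (simp add: z_def)
    ultimately show "\<exists>k z. k > N \<and> int p ^ (h * k) dvd qeval z (g (h * k)) \<and>
      \<bar>of_int (fst z)\<bar> \<le> K * r ^ k \<and> \<bar>of_int (snd z)\<bar> \<le> K * r ^ k \<and>
      r ^ k \<le> K * of_int (max \<bar>fst z\<bar> \<bar>snd z\<bar>) \<and> \<bar>qeval z a\<bar> \<le> K * r ^ k / real k"
      using k by blast
  qed
qed

text \<open>A Pell solution gives a unit with real values \<open>A\<close> and
  \<open>B = 1 / A\<close>, whose ratio is \<open>A^2\<close>. With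
  \<open>\<omega> = ln (A^2)\<close>, nonzero since \<open>A\<close> differs from \<open>B\<close>,
  the powers of the unit and of its conjugate realise every ratio
  \<open>exp (l * \<omega>)\<close>.\<close>

lemma exists_units:
  fixes s x y :: real
  assumes D: "t\<^sup>2 - 4 * n > 0"
    and s: "s\<^sup>2 = of_int (t\<^sup>2 - 4 * n)" and x: "x = (of_int t + s) / 2" and y: "y = (of_int t - s) / 2"
  obtains \<omega> :: real where "\<omega> \<noteq> 0"
    "\<And>l :: int. \<exists>\<eta>. qnorm t n \<eta> = 1 \<and> qeval \<eta> y \<noteq> 0 \<and> qeval \<eta> x = exp (of_int l * \<omega>) * qeval \<eta> y"
proof -
  have nonsq: "v = 0" if "u\<^sup>2 = (t\<^sup>2 - 4 * n) * v\<^sup>2" for u v :: int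
  proof -
    have "qnorm t n (u - t * v, 2 * v) = 0"
      using that by (simp add: qnorm_def algebra_simps power2_eq_square)
    from anisotropic[OF this] show ?thesis by simp
  qed
  obtain u v where uv: "u\<^sup>2 - (t\<^sup>2 - 4 * n) * v\<^sup>2 = 1" "v \<noteq> 0"
    using Pell_solution_exists[OF D] nonsq by metis
  define A B where "A = of_int u + of_int v * s" and "B = of_int u - of_int v * s"
  have "A * B = of_int (u\<^sup>2) - s\<^sup>2 * of_int (v\<^sup>2)"
    by (simp add: A_def B_def algebra_simps power2_eq_square)
  also have "\<dots> = of_int (u\<^sup>2 - (t\<^sup>2 - 4 * n) * v\<^sup>2)" unfolding s by simp
  finally have AB: "A * B = 1" using uv by simp
  hence nz: "A \<noteq> 0" "B \<noteq> 0" by auto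
  have A2: "B / A = inverse (A\<^sup>2)" using AB nz by (auto simp: field_simps power2_eq_square)
  have s0: "s \<noteq> 0" using D s by (metis less_irrefl of_int_eq_0_iff zero_eq_power2)
  have "A\<^sup>2 \<noteq> 1"
  proof
    assume "A\<^sup>2 = 1"
    hence "A = B" using AB by (metis mult_left_cancel nz(1) power2_eq_square)
    thus False using s0 uv(2) by (simp add: A_def B_def)
  qed
  define \<omega> where "\<omega> = ln (A\<^sup>2)"
  have \<omega>: "\<omega> \<noteq> 0" "exp \<omega> = A\<^sup>2" using nz \<open>A\<^sup>2 \<noteq> 1\<close> by (auto simp: \<omega>_def)
  have rx: "x\<^sup>2 - of_int t * x + of_int n = 0" and ry: "y\<^sup>2 - of_int t * y + of_int n = 0"
    using s unfolding x y by (auto simp: field_simps power2_eq_square)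
  \<comment> \<open>The square root of the discriminant is \<open>2 \<gamma> - t\<close>, so
    \<open>e\<close> stands for \<open>u + v (2 \<gamma> - t)\<close> and \<open>e'\<close> for its
    conjugate.\<close>
  define e where "e = (u - t * v, 2 * v)"
  define e' where "e' = (u + t * v, - 2 * v)"
  have ev: "qeval e x = A" "qeval e y = B" "qeval e' x = B" "qeval e' y = A"
    by (auto simp: e_def e'_def qeval_def A_def B_def x y field_simps)
  have nm: "qnorm t n e = 1" "qnorm t n e' = 1"
    using uv by (auto simp: e_def e'_def qnorm_def algebra_simps power2_eq_square)
  have "\<exists>\<eta>. qnorm t n \<eta> = 1 \<and> qeval \<eta> y \<noteq> 0 \<and> qeval \<eta> x = exp (of_int l * \<omega>) * qeval \<eta> y" for l :: int
  proof (cases "l \<ge> 0")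
    case True
    then obtain k where k: "l = int k" using nonneg_int_cases by blast
    have "A = A\<^sup>2 * B" using AB by (simp add: power2_eq_square)
    hence "A ^ k = (A\<^sup>2) ^ k * B ^ k" by (metis power_mult_distrib)
    also have "(A\<^sup>2) ^ k = exp (of_int l * \<omega>)" by (simp add: k exp_of_nat_mult \<omega>)
    finally show ?thesis using nz
      by (intro exI[of _ "qpow t n e k"])
        (simp add: qnorm_qpow nm qeval_qpow_root[OF rx] qeval_qpow_root[OF ry] ev)
  next
    case False
    then obtain k where k: "l = - int k" by (metis int_cases3 nle_le of_nat_0_le_iff)
    have "B = inverse (A\<^sup>2) * A" using A2 nz by (simp add: field_simps)
    hence "B ^ k = inverse ((A\<^sup>2) ^ k) * A ^ k"
      by (metis power_inverse power_mult_distrib)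
    also have "inverse ((A\<^sup>2) ^ k) = exp (of_int l * \<omega>)" by (simp add: k exp_minus exp_of_nat_mult \<omega>)
    finally show ?thesis using nz
      by (intro exI[of _ "qpow t n e' k"])
        (simp add: qnorm_qpow nm qeval_qpow_root[OF rx] qeval_qpow_root[OF ry] ev)
  qed
  thus ?thesis using that \<omega>(1) by blast
qed

text \<open>With \<open>x\<close>, \<open>y\<close> the real roots, \<open>qeval z a\<close> is small compared to \<open>z\<close> exactly when the ratio of the two real
  embeddings of \<open>z\<close> is close to \<open>(a - x) / (a - y)\<close>. Taking \<open>z = \<rho>\<^sup>k \<eta> x\<^sub>0\<close> with a unit \<open>\<eta>\<close>, the factor \<open>x\<^sub>0\<close>
  (either \<open>1\<close> or the square root of the discriminant) fixes the sign of that ratio, and its logarithm is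
  handled by inhomogeneous approximation.\<close>

lemma good_approx_real:
  assumes D: "t\<^sup>2 - 4 * n > 0" and a: "a\<^sup>2 - of_int t * a + of_int n \<noteq> 0"
  shows "good_approx (padic_dist_le p g) a"
proof -
  obtain \<rho> h where h: "h \<ge> 1" and \<rho>: "qnorm t n \<rho> = int p ^ h" "int p dvd qeval \<rho> (g 1)"
    "\<not> int p dvd qeval \<rho> (t - g 1)"
    using exists_uniformizer by blast
  define s where "s = sqrt (of_int (t\<^sup>2 - 4 * n))"
  have "(of_int (t\<^sup>2 - 4 * n) :: real) > 0" using D by (subst of_int_0_less_iff)
  hence s: "s > 0" "s\<^sup>2 = of_int (t\<^sup>2 - 4 * n)"
    unfolding s_def by (simp_all del: of_int_diff)
  define x y where "x = (of_int t + s) / 2" and "y = (of_int t - s) / 2"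
  have rx: "x\<^sup>2 - of_int t * x + of_int n = 0" and ry: "y\<^sup>2 - of_int t * y + of_int n = 0"
    using s(2) unfolding x_def y_def by (auto simp: field_simps power2_eq_square)
  have xy: "x - y = s" "y = of_int t - x" by (auto simp: x_def y_def field_simps)
  have nrm: "qeval z x * qeval z y = of_int (qnorm t n z)" for z
    using qeval_conj_mult[of z x t n] rx xy by simp
  have ax: "a \<noteq> x" and ay: "a \<noteq> y" using rx ry a by auto
  obtain \<omega> where \<omega>: "\<omega> \<noteq> 0"
    "\<And>l :: int. \<exists>\<eta>. qnorm t n \<eta> = 1 \<and> qeval \<eta> y \<noteq> 0 \<and> qeval \<eta> x = exp (of_int l * \<omega>) * qeval \<eta> y"
    using exists_units[OF D s(2) x_def y_def] by blast
  define r where "r = sqrt (real p ^ h)"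
  have ph: "real p ^ h > 1" using prime prime_gt_1_nat[of p] h by (intro one_less_power) auto
  have r1: "r > 1" and r2: "r\<^sup>2 = real p ^ h" using ph by (auto simp: r_def)
  have \<rho>xy: "qeval \<rho> x * qeval \<rho> y = real p ^ h" using nrm[of \<rho>] \<rho> by simp
  hence \<rho>y: "qeval \<rho> y \<noteq> 0" using ph by (metis mult_zero_right not_one_less_zero)
  \<comment> \<open>The norm of \<open>\<rho>\<close> is positive, so its two real values have the
    same sign and their ratio has a logarithm.\<close>
  have pos: "qeval \<rho> x / qeval \<rho> y > 0"
    using \<rho>xy ph by (smt (verit) zero_less_divide_iff zero_less_mult_iff)
  define \<tau> where "\<tau> = ln (qeval \<rho> x / qeval \<rho> y)"
  have \<tau>: "qeval \<rho> x = exp \<tau> * qeval \<rho> y" using pos \<rho>y by (simp add: \<tau>_def)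
  have pw: "qeval (qpow t n \<rho> k) x = exp (real k * \<tau>) * qeval (qpow t n \<rho> k) y" for k
    unfolding qeval_qpow_root[OF rx] qeval_qpow_root[OF ry] \<tau> by (simp add: exp_of_nat_mult power_mult_distrib)
  have snd: "of_int (snd z) * s = qeval z x - qeval z y" for z
    using xy(1) by (simp add: qeval_def flip: right_diff_distrib)
  \<comment> \<open>A relation \<open>d * \<tau> = c * \<omega>\<close> would give a unit
    \<open>\<eta>\<close> such that \<open>\<rho>^d \<eta>\<close> has equal real values and is
    therefore a rational integer.\<close>
  have irr: "\<tau> / \<omega> \<notin> \<rat>"
  proof
    assume "\<tau> / \<omega> \<in> \<rat>"
    then obtain c d :: int where cd: "\<tau> / \<omega> = of_int c / of_int d" "d > 0" by (meson Rats_cases')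
    obtain \<eta> where \<eta>: "qnorm t n \<eta> = 1" "qeval \<eta> x = exp (of_int (- c) * \<omega>) * qeval \<eta> y"
      using \<omega>(2) by blast
    define w where "w = qmul t n (qpow t n \<rho> (nat d)) \<eta>"
    have e: "real (nat d) * \<tau> + of_int (- c) * \<omega> = 0" using cd \<omega>(1) by (simp add: field_simps)
    have "qeval w x = exp (real (nat d) * \<tau>) * exp (of_int (- c) * \<omega>) * qeval w y"
      unfolding w_def qeval_qmul_root[OF rx] qeval_qmul_root[OF ry] pw \<eta>(2) by simp
    also have "exp (real (nat d) * \<tau>) * exp (of_int (- c) * \<omega>) = 1"
      unfolding exp_add[symmetric] e by simp
    finally have "snd w = 0" using snd[of w] s(1) by simp
    moreover have "snd w \<noteq> 0"
      unfolding w_def using cd(2) by (intro uniformizer_qpow_not_integer \<rho> \<eta>) auto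
    ultimately show False by simp
  qed
  define q where "q = (a - x) / (a - y)"
  define \<Gamma> where "\<Gamma> = ln \<bar>q\<bar>"
  have "q \<noteq> 0" using ax ay by (simp add: q_def)
  hence q: "q \<noteq> 0" "q = sgn q * exp \<Gamma>" by (auto simp: \<Gamma>_def sgn_mult_abs)
  define x0 :: "int \<times> int" where "x0 = (if q > 0 then (1, 0) else (- t, 2))"
  have x0x: "qeval x0 x = sgn q * qeval x0 y"
    using q(1) xy(2) by (cases "q > 0") (simp_all add: x0_def qeval_def)
  have x0n: "qnorm t n x0 = (if q > 0 then 1 else - (t\<^sup>2 - 4 * n))"
    by (auto simp: x0_def qnorm_def algebra_simps power2_eq_square)
  define n0 where "n0 = \<bar>real_of_int (qnorm t n x0)\<bar>"
  have "\<bar>qnorm t n x0\<bar> \<ge> 1" using D by (auto simp: x0n)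
  hence n0: "n0 \<ge> 1" unfolding n0_def by linarith
  \<comment> \<open>\<open>Y\<close> bounds the absolute value of \<open>b\<close> below, since
    \<open>b\<close> will lie within \<open>6 * |\<omega>|\<close> of
    \<open>\<Gamma>\<close>.\<close>
  define Y where "Y = \<bar>\<Gamma>\<bar> + 6 * \<bar>\<omega>\<bar>"
  have Y: "Y \<ge> 0" by (simp add: Y_def)
  define K1 where "K1 = n0 * exp Y"
  have K1: "K1 \<ge> 1" using n0 Y unfolding K1_def by (smt (verit) mult_le_cancel_left1 one_le_exp_iff)
  define \<mu> where "\<mu> = \<bar>(a - y) / s\<bar> * K1 * exp Y * (6 * \<bar>\<omega>\<bar>)"
  define K where "K = 2 * K1 / s + (K1 + 2 * K1 * \<bar>x\<bar> / s) + exp Y * (1 + \<bar>x\<bar>) + \<mu>"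
  have Kparts: "2 * K1 / s \<ge> 0" "2 * K1 * \<bar>x\<bar> / s \<ge> 0" "exp Y * (1 + \<bar>x\<bar>) \<ge> 0" "\<mu> \<ge> 0"
    using s K1 by (auto simp: \<mu>_def)
  have K0: "K > 0" using Kparts K1 unfolding K_def by linarith
  show ?thesis
  proof (rule good_approxI[OF r1 r2 K0])
    fix N
    obtain k l where k: "k > N" and kl: "\<bar>real k * (\<tau> / \<omega>) - of_int l - \<Gamma> / \<omega>\<bar> \<le> 6 / real k"
      using inhomogeneous_approx[OF irr] by blast
    have k1: "real k \<ge> 1" using k by simp
    obtain \<eta> where \<eta>: "qnorm t n \<eta> = 1" "qeval \<eta> x = exp (of_int (- l) * \<omega>) * qeval \<eta> y"
      using \<omega>(2) by blast
    define b where "b = real k * \<tau> + of_int (- l) * \<omega>"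
    have "b - \<Gamma> = (real k * (\<tau> / \<omega>) - of_int l - \<Gamma> / \<omega>) * \<omega>"
      using \<omega>(1) by (simp add: b_def field_simps)
    hence "\<bar>b - \<Gamma>\<bar> = \<bar>real k * (\<tau> / \<omega>) - of_int l - \<Gamma> / \<omega>\<bar> * \<bar>\<omega>\<bar>" by (simp add: abs_mult)
    also have "\<dots> \<le> 6 / real k * \<bar>\<omega>\<bar>" using kl by (intro mult_right_mono) auto
    finally have b\<Gamma>: "\<bar>b - \<Gamma>\<bar> \<le> 6 * \<bar>\<omega>\<bar> / real k" by simp
    also have "\<dots> \<le> 6 * \<bar>\<omega>\<bar>"
      using k1 by (simp add: divide_le_eq mult_le_cancel_left1)
    finally have bY: "b \<le> Y" "- Y \<le> b" unfolding Y_def by linarith+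
    define z where "z = qmul t n (qpow t n \<rho> k) (qmul t n \<eta> x0)"
    have zx: "qeval z x = sgn q * exp b * qeval z y"
      unfolding z_def qeval_qmul_root[OF rx] qeval_qmul_root[OF ry] pw \<eta>(2) x0x b_def exp_add
      by simp
    have sg: "\<bar>sgn q\<bar> = 1" using q(1) by (simp add: abs_sgn_eq)
    have zabs: "\<bar>qeval z x\<bar> = exp b * \<bar>qeval z y\<bar>" unfolding zx abs_mult sg by simp
    have "qeval z x * qeval z y = of_int (qnorm t n \<rho> ^ k * qnorm t n x0)"
      unfolding nrm z_def qnorm_qmul qnorm_qpow \<eta> by simp
    also have "\<dots> = (r ^ k)\<^sup>2 * of_int (qnorm t n x0)"
    proof -
      have "(r ^ k)\<^sup>2 = (real p ^ h) ^ k"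
        unfolding r2[symmetric] by (simp add: power_mult[symmetric] mult.commute)
      thus ?thesis by (simp add: \<rho>(1))
    qed
    finally have prod: "\<bar>qeval z x\<bar> * \<bar>qeval z y\<bar> = (r ^ k)\<^sup>2 * n0"
      unfolding n0_def abs_mult[symmetric] by (simp add: abs_mult)
    have rk: "r ^ k > 0" using r1 by simp
    \<comment> \<open>The product of the two absolute values is fixed by the norm and their ratio is
      \<open>exp b\<close>, so both are determined and of order \<open>r^k\<close>.\<close>
    have "\<bar>qeval z x\<bar>\<^sup>2 = exp b * (\<bar>qeval z x\<bar> * \<bar>qeval z y\<bar>)"
      by (simp add: zabs power2_eq_square)
    hence sqx: "\<bar>qeval z x\<bar>\<^sup>2 = exp b * n0 * (r ^ k)\<^sup>2" unfolding prod by simp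
    have "\<bar>qeval z y\<bar>\<^sup>2 = exp (- b) * (\<bar>qeval z x\<bar> * \<bar>qeval z y\<bar>)"
      by (simp add: zabs power2_eq_square exp_minus mult.assoc[symmetric])
    hence sqy: "\<bar>qeval z y\<bar>\<^sup>2 = exp (- b) * n0 * (r ^ k)\<^sup>2" unfolding prod by simp
    have up: "exp c * n0 * (r ^ k)\<^sup>2 \<le> (K1 * r ^ k)\<^sup>2" if "c \<le> Y" for c
    proof -
      have "exp c * n0 \<le> K1" unfolding K1_def using that n0 by (simp add: mult.commute)
      also have "\<dots> \<le> K1\<^sup>2" using K1 by (simp add: power2_eq_square mult_le_cancel_left1)
      finally show ?thesis using rk by (simp add: power_mult_distrib mult_right_mono)
    qed
    have hx: "\<bar>qeval z x\<bar> \<le> K1 * r ^ k"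
      by (rule power2_le_imp_le) (use sqx up[of b] bY K1 rk in auto)
    have hy: "\<bar>qeval z y\<bar> \<le> K1 * r ^ k"
      by (rule power2_le_imp_le) (use sqy up[of "- b"] bY K1 rk in auto)
    have "(exp (- Y) * r ^ k)\<^sup>2 \<le> \<bar>qeval z x\<bar>\<^sup>2"
    proof -
      have "(exp (- Y))\<^sup>2 \<le> exp (- Y) * 1"
        using Y by (simp add: power2_eq_square)
      also have "\<dots> \<le> exp b * n0" using bY n0 by (intro mult_mono) auto
      finally show ?thesis unfolding sqx power_mult_distrib by (intro mult_right_mono) auto
    qed
    hence "exp (- Y) * r ^ k \<le> \<bar>qeval z x\<bar>" by (rule power2_le_imp_le) simp
    hence "r ^ k \<le> exp Y * \<bar>qeval z x\<bar>" by (simp add: exp_minus field_simps)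
    also have "\<dots> \<le> exp Y * ((1 + \<bar>x\<bar>) * of_int (max \<bar>fst z\<bar> \<bar>snd z\<bar>))"
      using norm_qeval_le_max[of z x] by (intro mult_left_mono) auto
    finally have lo: "r ^ k \<le> exp Y * (1 + \<bar>x\<bar>) * of_int (max \<bar>fst z\<bar> \<bar>snd z\<bar>)"
      by (simp only: mult.assoc)
    have "\<bar>of_int (snd z)\<bar> * s = \<bar>qeval z x - qeval z y\<bar>" using s by (simp add: abs_mult flip: snd)
    also have "\<dots> \<le> 2 * K1 * r ^ k" using hx hy by linarith
    finally have sz: "\<bar>of_int (snd z)\<bar> \<le> 2 * K1 / s * r ^ k" using s by (simp add: field_simps)
    have "\<bar>of_int (fst z)\<bar> = \<bar>qeval z x - of_int (snd z) * x\<bar>" by (simp add: qeval_def)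
    also have "\<dots> \<le> \<bar>qeval z x\<bar> + \<bar>of_int (snd z)\<bar> * \<bar>x\<bar>"
      using abs_triangle_ineq4 by (metis abs_mult)
    also have "\<dots> \<le> K1 * r ^ k + 2 * K1 / s * r ^ k * \<bar>x\<bar>"
      using hx sz by (intro add_mono mult_right_mono) auto
    finally have fz: "\<bar>of_int (fst z)\<bar> \<le> (K1 + 2 * K1 * \<bar>x\<bar> / s) * r ^ k" by (simp add: algebra_simps)
    \<comment> \<open>Linear interpolation between the two roots expresses the value at
      \<open>a\<close>; it vanishes exactly when the real values have ratio
      \<open>q\<close>.\<close>
    have "s * qeval z a = (a - y) * qeval z x - (a - x) * qeval z y"
      unfolding xy(1)[symmetric] by (simp add: qeval_def algebra_simps)
    also have "\<dots> = (a - y) * (qeval z x - q * qeval z y)"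
      using ay by (simp add: q_def field_simps)
    also have "q * qeval z y = sgn q * exp \<Gamma> * qeval z y" using q(2) by simp
    finally have "s * qeval z a = (a - y) * (sgn q * (exp b - exp \<Gamma>) * qeval z y)"
      by (simp add: zx algebra_simps)
    hence "qeval z a = (a - y) / s * (sgn q * (exp b - exp \<Gamma>) * qeval z y)"
      using s by (simp add: field_simps)
    hence "\<bar>qeval z a\<bar> = \<bar>(a - y) / s\<bar> * (\<bar>exp b - exp \<Gamma>\<bar> * \<bar>qeval z y\<bar>)"
      by (simp only: abs_mult sg mult_1_left)
    also have "\<dots> \<le> \<bar>(a - y) / s\<bar> * ((exp Y * (6 * \<bar>\<omega>\<bar> / real k)) * (K1 * r ^ k))"
    proof (intro mult_left_mono mult_mono hy)
      have "\<Gamma> \<le> Y" unfolding Y_def by linarith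
      hence "\<bar>exp b - exp \<Gamma>\<bar> \<le> exp Y * \<bar>b - \<Gamma>\<bar>" by (intro abs_exp_diff_le bY)
      also have "\<dots> \<le> exp Y * (6 * \<bar>\<omega>\<bar> / real k)" using b\<Gamma> by (intro mult_left_mono) auto
      finally show "\<bar>exp b - exp \<Gamma>\<bar> \<le> exp Y * (6 * \<bar>\<omega>\<bar> / real k)" .
    qed (use k1 in auto)
    also have "\<dots> = \<mu> * r ^ k / real k" by (simp add: \<mu>_def)
    finally have ap: "\<bar>qeval z a\<bar> \<le> \<mu> * r ^ k / real k" .
    have bd: "c * r ^ k \<le> K * r ^ k" if "c \<le> K" for c
      using that rk by (intro mult_right_mono) auto
    have "\<bar>of_int (fst z)\<bar> \<le> K * r ^ k"
      using Kparts by (intro order_trans[OF fz] bd) (simp add: K_def)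
    moreover have "\<bar>of_int (snd z)\<bar> \<le> K * r ^ k"
      using Kparts K1 by (intro order_trans[OF sz] bd) (simp add: K_def)
    moreover have "r ^ k \<le> K * of_int (max \<bar>fst z\<bar> \<bar>snd z\<bar>)"
      using Kparts K1 by (intro order_trans[OF lo] mult_right_mono) (auto simp: K_def)
    moreover have "\<bar>qeval z a\<bar> \<le> K * r ^ k / real k"
      using Kparts K1 by (intro order_trans[OF ap] divide_right_mono bd) (auto simp: K_def)
    moreover have "int p ^ (h * k) dvd qeval z (g (h * k))"
      using uniformizer_qpow_dvd[OF \<rho>(1,3), of k "qmul t n \<eta> x0"] k by (simp add: z_def)
    ultimately show "\<exists>k z. k > N \<and> int p ^ (h * k) dvd qeval z (g (h * k)) \<and>
      \<bar>of_int (fst z)\<bar> \<le> K * r ^ k \<and> \<bar>of_int (snd z)\<bar> \<le> K * r ^ k \<and>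
      r ^ k \<le> K * of_int (max \<bar>fst z\<bar> \<bar>snd z\<bar>) \<and> \<bar>qeval z a\<bar> \<le> K * r ^ k / real k"
      using k by blast
  qed
qed

text \<open>The two signatures are exhaustive: a zero discriminant would be divisible by
  \<open>p\<close>.\<close>

lemma good_approx_nonroot:
  assumes "a\<^sup>2 - of_int t * a + of_int n \<noteq> 0"
  shows "good_approx (padic_dist_le p g) a"
  using good_approx_imaginary good_approx_real[OF _ assms] unramified
  by (metis dvd_0_right linorder_neqE_linordered_idom)

end

text \<open>The integral substitution \<open>(u, v) -> (m u, b u + k v)\<close> has nonzero
  determinant \<open>m k\<close>, so it changes heights by at most the factor \<open>L\<close> in
  either direction, and it multiplies the real linear form by \<open>k\<close>.\<close>

lemma good_approx_linear:
  assumes good: "good_approx W a'" and m: "m \<noteq> 0" and k: "k \<noteq> 0"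
    and a': "a' = (of_int m * a - of_int b) / of_int k"
    and W: "\<And>u v w. W u v w \<Longrightarrow> w \<ge> 0 \<and> W' (m * u) (b * u + k * v) w"
  shows "good_approx W' a"
proof -
  obtain C where C: "C > 0" and ex: "\<And>N :: nat. \<exists>u v w.
     int N \<le> max \<bar>u\<bar> \<bar>v\<bar> \<and> W u v w \<and> (of_int (max \<bar>u\<bar> \<bar>v\<bar>))\<^sup>2 * w \<le> C \<and>
     \<bar>of_int u * a' - of_int v\<bar> * ln (of_int (max \<bar>u\<bar> \<bar>v\<bar>)) \<le> C * of_int (max \<bar>u\<bar> \<bar>v\<bar>)"
    using good unfolding good_approx_def by blast
  define L where "L = \<bar>m\<bar> + \<bar>b\<bar> + \<bar>k\<bar>"
  define c where "c = real_of_int \<bar>k\<bar>"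
  have L: "L \<ge> 2" using m k by (simp add: L_def)
  have c: "c > 0" using k by (simp add: c_def)
  define C' where "C' = (of_int L)\<^sup>2 * C + 2 * c * C * of_int L"
  have C'parts: "(of_int L)\<^sup>2 * C > 0" "2 * c * C * of_int L > 0" using C L c by auto
  show ?thesis unfolding good_approx_def
  proof (intro exI[of _ C'] conjI allI)
    show "C' > 0" using C'parts unfolding C'_def by linarith
    fix N :: nat
    \<comment> \<open>Height at least \<open>L * (N + 1)\<close> leaves more than \<open>N\<close>
      after the substitution. It also gives \<open>ln L <= ln M\<close>, which accounts for the
      factor 2 in \<open>C'\<close>.\<close>
    obtain u v w where N: "int (nat L * (N + 1)) \<le> max \<bar>u\<bar> \<bar>v\<bar>" and Ww: "W u v w"
      and 1: "(of_int (max \<bar>u\<bar> \<bar>v\<bar>))\<^sup>2 * w \<le> C"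
      and 2: "\<bar>of_int u * a' - of_int v\<bar> * ln (of_int (max \<bar>u\<bar> \<bar>v\<bar>)) \<le> C * of_int (max \<bar>u\<bar> \<bar>v\<bar>)"
      using ex by blast
    define M where "M = max \<bar>u\<bar> \<bar>v\<bar>"
    define M' where "M' = max \<bar>m * u\<bar> \<bar>b * u + k * v\<bar>"
    note 1 = 1[folded M_def] and 2 = 2[folded M_def]
    have uM: "\<bar>u\<bar> \<le> M" "\<bar>v\<bar> \<le> M" by (auto simp: M_def)
    have LN: "L * (int N + 1) \<le> M" using N L by (simp add: M_def algebra_simps)
    have LM: "L \<le> M"
    proof -
      have "L * 1 \<le> L * (int N + 1)" using L by (intro mult_left_mono) auto
      thus ?thesis using LN by simp
    qed
    have m1: "\<bar>m * u\<bar> \<le> \<bar>m\<bar> * M" "\<bar>b * u\<bar> \<le> \<bar>b\<bar> * M" "\<bar>k * v\<bar> \<le> \<bar>k\<bar> * M"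
      unfolding abs_mult using uM by (auto intro: mult_left_mono)
    have pos: "\<bar>m\<bar> * M \<ge> 0" "\<bar>b\<bar> * M \<ge> 0" "\<bar>k\<bar> * M \<ge> 0" using LM L by auto
    have up: "M' \<le> L * M"
      using m1 pos unfolding M'_def L_def distrib_right by linarith
    have "1 * \<bar>u\<bar> \<le> \<bar>m\<bar> * \<bar>u\<bar>" using m by (intro mult_right_mono) auto
    hence uM': "\<bar>u\<bar> \<le> M'" unfolding M'_def abs_mult by simp
    have "1 * \<bar>v\<bar> \<le> \<bar>k\<bar> * \<bar>v\<bar>" using k by (intro mult_right_mono) auto
    also have "\<dots> = \<bar>(b * u + k * v) - b * u\<bar>" by (simp add: abs_mult)
    also have "\<dots> \<le> \<bar>b * u + k * v\<bar> + \<bar>b * u\<bar>" by (rule abs_triangle_ineq4)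
    also have "\<dots> \<le> M' + \<bar>b\<bar> * M'"
      unfolding abs_mult[of b] using uM' by (intro add_mono mult_left_mono) (auto simp: M'_def)
    finally have vM': "\<bar>v\<bar> \<le> (1 + \<bar>b\<bar>) * M'" by (simp add: algebra_simps)
    have M'0: "M' \<ge> 0" by (simp add: M'_def)
    have "(1 + \<bar>b\<bar>) * M' \<le> L * M'" using m k M'0 by (intro mult_right_mono) (auto simp: L_def)
    moreover have "1 * M' \<le> L * M'" using L M'0 by (intro mult_right_mono) auto
    ultimately have lo: "M \<le> L * M'" using uM' vM' unfolding M_def by linarith
    have "L * int N < L * M'" using lo LN L unfolding distrib_left by linarith
    hence NM': "int N < M'" using L by simp
    have rup: "real_of_int M' \<le> of_int L * of_int M" and rlo: "real_of_int M \<le> of_int L * of_int M'"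
      using up lo by (simp_all flip: of_int_mult)
    have rpos: "real_of_int M' > 0" "real_of_int M > 0" "real_of_int L \<le> of_int M" "real_of_int L > 0"
      using NM' LM L by auto
    have W0: "w \<ge> 0" and W'w: "W' (m * u) (b * u + k * v) w" using W[OF Ww] by auto
    have "(of_int M')\<^sup>2 * w \<le> (of_int L * of_int M)\<^sup>2 * w"
      using rup rpos W0 by (intro mult_right_mono power_mono) auto
    also have "\<dots> = (of_int L)\<^sup>2 * ((of_int M)\<^sup>2 * w)" by (simp add: power_mult_distrib)
    also have "\<dots> \<le> (of_int L)\<^sup>2 * C" using 1 by (intro mult_left_mono) auto
    also have "\<dots> \<le> C'" using C'parts unfolding C'_def by linarith
    finally have A: "(of_int M')\<^sup>2 * w \<le> C'" .
    have "ln (real_of_int M') \<le> ln (of_int L * of_int M)" using rup rpos by (intro ln_mono) auto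
    also have "\<dots> = ln (of_int L) + ln (of_int M)" using rpos by (intro ln_mult_pos) auto
    also have "\<dots> \<le> 2 * ln (of_int M)" using ln_mono[OF rpos(3,4)] by simp
    finally have lnM: "ln (real_of_int M') \<le> 2 * ln (real_of_int M)" .
    have eq: "of_int (m * u) * a - of_int (b * u + k * v) = of_int k * (of_int u * a' - of_int v)"
      using k by (simp add: a' field_simps)
    have "\<bar>of_int (m * u) * a - of_int (b * u + k * v)\<bar> * ln (of_int M')
        = c * (\<bar>of_int u * a' - of_int v\<bar> * ln (of_int M'))"
      unfolding eq abs_mult c_def by simp
    also have "\<dots> \<le> c * (\<bar>of_int u * a' - of_int v\<bar> * (2 * ln (of_int M)))"
      using lnM c by (intro mult_left_mono) auto
    also have "\<dots> = 2 * c * (\<bar>of_int u * a' - of_int v\<bar> * ln (of_int M))" by simp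
    also have "\<dots> \<le> 2 * c * (C * of_int M)" using 2 c by (intro mult_left_mono) auto
    also have "\<dots> \<le> 2 * c * (C * (of_int L * of_int M'))"
      using rlo c C by (intro mult_left_mono) auto
    also have "\<dots> = 2 * c * C * of_int L * of_int M'" by simp
    also have "\<dots> \<le> C' * of_int M'"
    proof (rule mult_right_mono)
      show "2 * c * C * of_int L \<le> C'" using C'parts unfolding C'_def by linarith
    qed (use rpos in simp)
    finally have B: "\<bar>of_int (m * u) * a - of_int (b * u + k * v)\<bar> * ln (of_int M') \<le> C' * of_int M'" .
    show "\<exists>u v w. int N \<le> max \<bar>u\<bar> \<bar>v\<bar> \<and> W' u v w \<and> (of_int (max \<bar>u\<bar> \<bar>v\<bar>))\<^sup>2 * w \<le> C' \<and>
     \<bar>of_int u * a - of_int v\<bar> * ln (of_int (max \<bar>u\<bar> \<bar>v\<bar>)) \<le> C' * of_int (max \<bar>u\<bar> \<bar>v\<bar>)"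
      using A B W'w NM' unfolding M'_def by (meson less_imp_le)
  qed
qed

text \<open>Replacing \<open>\<delta> = \<surd>D\<close> by \<open>\<gamma> = (s - \<delta>) / p\<^sup>j\<close>, with \<open>s\<close> an integer close to \<open>\<delta>\<close> and \<open>p\<^sup>j\<close> the exact power
  of \<open>p\<close> in \<open>2 s\<close>, makes the discriminant prime to \<open>p\<close>.\<close>

lemma good_approx_sqrt:
  fixes D :: int and d :: "nat \<Rightarrow> int"
  assumes p: "prime p" and root: "\<And>i. int p ^ i dvd (d i)\<^sup>2 - D"
    and coh: "\<And>i. int p ^ i dvd d (Suc i) - d i"
    and nonsq: "\<And>x y :: int. x\<^sup>2 = D * y\<^sup>2 \<Longrightarrow> y = 0" and a: "a\<^sup>2 \<noteq> of_int D"
  shows "good_approx (padic_dist_le p d) a"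
proof -
  let ?p = "int p"
  have pp: "prime ?p" and p1: "?p > 1" using p prime_gt_1_nat by auto
  have pz: "?p \<noteq> 0" "\<not> is_unit ?p" using p1 by auto
  have D0: "D \<noteq> 0" using nonsq[of 0 1] by auto
  \<comment> \<open>\<open>p^i0\<close> does not divide \<open>4 * D\<close>, hence not
    \<open>4 * s^2\<close> either, as \<open>s^2\<close> agrees with \<open>D\<close> modulo
    \<open>p^i0\<close>. This forces \<open>2 * j < i0\<close>, so \<open>s^2 - D\<close> is
    divisible by \<open>p^(2 * j + 1)\<close>.\<close>
  define i0 where "i0 = multiplicity ?p (4 * D) + 1"
  define s where "s = d i0"
  have "\<not> ?p ^ i0 dvd 4 * D"
    unfolding i0_def using D0 pz by (simp add: power_dvd_iff_le_multiplicity del: power_Suc)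
  moreover have "?p ^ i0 dvd 4 * s\<^sup>2 - 4 * D"
    using dvd_mult[OF root[of i0], of 4] by (simp add: s_def right_diff_distrib)
  ultimately have s4: "\<not> ?p ^ i0 dvd 4 * s\<^sup>2" using dvd_diff_imp_dvd_iff by blast
  hence s0: "s \<noteq> 0" by auto
  define j where "j = multiplicity ?p (2 * s)"
  obtain t where t: "2 * s = ?p ^ j * t" "\<not> ?p dvd t"
    using multiplicity_decompose'[of "2 * s" ?p] s0 pz unfolding j_def by auto
  define q where "q = ?p ^ j"
  have q0: "q > 0" using p1 by (simp add: q_def)
  have "4 * s\<^sup>2 = (2 * s)\<^sup>2" by (simp add: power2_eq_square)
  also have "\<dots> = ?p ^ (2 * j) * t\<^sup>2" unfolding t(1) by (simp add: power_mult_distrib power_mult[symmetric] mult.commute)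
  finally have "\<not> i0 \<le> 2 * j" using s4 le_imp_power_dvd by (metis dvd_mult2)
  hence i0: "2 * j + 1 \<le> i0" by simp
  have "?p ^ (2 * j + 1) dvd s\<^sup>2 - D"
    using root[of i0] le_imp_power_dvd[OF i0, of ?p] unfolding s_def by (rule dvd_trans[rotated])
  then obtain n' where n': "s\<^sup>2 - D = ?p ^ (2 * j + 1) * n'" by (auto elim: dvdE)
  \<comment> \<open>\<open>t\<close> and \<open>n\<close> are the trace and norm of
    \<open>\<gamma>\<close>. The spare power of \<open>p\<close> goes into \<open>n\<close> while
    \<open>t\<close> is prime to \<open>p\<close>, so \<open>t^2 - 4 * n\<close> is prime to
    \<open>p\<close>, also for \<open>p = 2\<close>.\<close>
  define n where "n = ?p * n'"
  have qq: "?p ^ (2 * j) = q\<^sup>2" by (simp add: q_def power_mult[symmetric] mult.commute)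
  have n: "s\<^sup>2 - D = q\<^sup>2 * n" unfolding n' n_def qq[symmetric] by simp
  have t': "2 * s = q * t" using t by (simp add: q_def)
  have disc: "q\<^sup>2 * (t\<^sup>2 - 4 * n) = 4 * D"
  proof -
    have "q\<^sup>2 * (t\<^sup>2 - 4 * n) = (q * t)\<^sup>2 - 4 * (q\<^sup>2 * n)" by (simp add: algebra_simps power2_eq_square)
    thus ?thesis unfolding t'[symmetric] n[symmetric] by (simp add: power2_eq_square)
  qed
  have cohle: "?p ^ i dvd d j - d i" if "i \<le> j" for i j
    using coherent_dvd_diff[OF coh that] .
  have "q dvd s - d (i + i0)" for i
  proof -
    have "q dvd ?p ^ i0" unfolding q_def using i0 by (intro le_imp_power_dvd) simp
    also have "?p ^ i0 dvd d (i + i0) - s" using cohle[of i0 "i + i0"] by (simp add: s_def)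
    finally show ?thesis by (simp add: dvd_diff_commute)
  qed
  hence "\<exists>x. s - d (i + i0) = q * x" for i by (auto elim: dvdE)
  \<comment> \<open>The truncations of \<open>\<gamma>\<close>; the shift by \<open>i0\<close>
    supplies the precision lost by dividing by \<open>q\<close> and \<open>q^2\<close>.\<close>
  then obtain g where g: "\<And>i. s - d (i + i0) = q * g i" by metis
  interpret padic_quadratic_integer p t n g
  proof
    fix i
    show "prime p" by fact
    have "q\<^sup>2 * ((g i)\<^sup>2 - t * g i + n) = (q * g i)\<^sup>2 - (q * t) * (q * g i) + q\<^sup>2 * n"
      by (simp add: algebra_simps power2_eq_square)
    also have "\<dots> = (d (i + i0))\<^sup>2 - D"
      unfolding g[symmetric] t'[symmetric] n[symmetric] by (simp add: algebra_simps power2_eq_square)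
    finally have "?p ^ (i + i0) dvd q\<^sup>2 * ((g i)\<^sup>2 - t * g i + n)" using root by simp
    moreover have "q\<^sup>2 * ?p ^ i dvd ?p ^ (i + i0)"
      unfolding qq[symmetric] power_add[symmetric] using i0 by (intro le_imp_power_dvd) simp
    ultimately have "q\<^sup>2 * ?p ^ i dvd q\<^sup>2 * ((g i)\<^sup>2 - t * g i + n)" by (rule dvd_trans[rotated])
    thus "?p ^ i dvd (g i)\<^sup>2 - t * g i + n" using q0 by simp
    have "q * (g (Suc i) - g i) = - (d (Suc (i + i0)) - d (i + i0))"
      unfolding right_diff_distrib g[symmetric] by simp
    hence "?p ^ (i + i0) dvd q * (g (Suc i) - g i)" using coh[of "i + i0"] by (metis dvd_minus_iff)
    moreover have "q * ?p ^ i dvd ?p ^ (i + i0)"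
      unfolding q_def power_add[symmetric] using i0 by (intro le_imp_power_dvd) simp
    ultimately have "q * ?p ^ i dvd q * (g (Suc i) - g i)" by (rule dvd_trans[rotated])
    thus "?p ^ i dvd g (Suc i) - g i" using q0 by simp
  next
    have "?p dvd 4 * n" by (simp add: n_def)
    moreover have "\<not> ?p dvd t\<^sup>2" using t(2) pp prime_dvd_power by blast
    ultimately show "\<not> ?p dvd t\<^sup>2 - 4 * n" using dvd_add[of ?p "t\<^sup>2 - 4 * n" "4 * n"] by auto
  next
    \<comment> \<open>Completing the square turns a zero of the norm form into a square that is
      \<open>D\<close> times a square.\<close>
    fix z assume z: "qnorm t n z = 0"
    have "(q * (2 * fst z + t * snd z))\<^sup>2 = q\<^sup>2 * (4 * qnorm t n z + (t\<^sup>2 - 4 * n) * (snd z)\<^sup>2)"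
      by (simp add: qnorm_def algebra_simps power2_eq_square)
    also have "\<dots> = q\<^sup>2 * (t\<^sup>2 - 4 * n) * (snd z)\<^sup>2" by (simp add: z)
    also have "\<dots> = D * (2 * snd z)\<^sup>2" unfolding disc by (simp add: power2_eq_square)
    finally have "2 * snd z = 0" by (rule nonsq)
    hence sz: "snd z = 0" by simp
    hence "fst z = 0" using z by (simp add: qnorm_def)
    thus "z = (0, 0)" using sz by (simp add: prod_eq_iff)
  qed
  define a' where "a' = (of_int s - a) / of_int q"
  have qa: "of_int q * a' = of_int s - a" using q0 by (simp add: a'_def)
  have "(of_int q)\<^sup>2 * (a'\<^sup>2 - of_int t * a' + of_int n)
      = (of_int q * a')\<^sup>2 - of_int (q * t) * (of_int q * a') + of_int (q\<^sup>2 * n)"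
    by (simp add: algebra_simps power2_eq_square)
  also have "\<dots> = a\<^sup>2 - of_int D"
    unfolding qa t'[symmetric] n[symmetric] by (simp add: algebra_simps power2_eq_square)
  finally have "a'\<^sup>2 - of_int t * a' + of_int n \<noteq> 0" using a by auto
  from good_approx_nonroot[OF this] show ?thesis
  proof (rule good_approx_linear[where m = 1 and b = s and k = "- q"])
    show "- q \<noteq> 0" using q0 by simp
    show "a' = (of_int 1 * a - of_int s) / of_int (- q)"
      using q0 by (simp add: a'_def field_simps)
    fix u v w assume "padic_dist_le p g u v w"
    then obtain m where m: "w = 1 / real p ^ m" "?p ^ m dvd u * g m - v"
      by (auto simp: padic_dist_le_def)
    have "u * d m - (s * u + - q * v) = - (u * (s - d (m + i0)) - q * v) - u * (d (m + i0) - d m)"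
      by (simp add: algebra_simps)
    also have "\<dots> = - q * (u * g m - v) - u * (d (m + i0) - d m)"
      unfolding g by (simp add: algebra_simps)
    finally have "?p ^ m dvd u * d m - (s * u + - q * v)"
      using m(2) cohle[of m "m + i0"] by simp
    thus "w \<ge> 0 \<and> padic_dist_le p d (1 * u) (s * u + - q * v) w"
      using m(1) by (auto simp: padic_dist_le_def)
  qed simp
qed

section \<open>Transfer to the field of \<open>p\<close>-adic numbers\<close>

lemma rat_padic_abs_of_int_le_iff:
  assumes p: "prime p"
  shows "rat_padic_abs p (of_int x) \<le> 1 / real p ^ m \<longleftrightarrow> int p ^ m dvd x"
proof (cases "x = 0")
  case False
  have p1: "real p > 1" "\<not> is_unit (int p)" using p prime_gt_1_nat[of p] by auto
  have "rat_padic_abs p (of_int x) = 1 / real p ^ multiplicity (int p) x"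
    using rat_padic_abs_frac[OF p False, of 1] by (simp add: power_int_minus divide_inverse)
  also have "\<dots> \<le> 1 / real p ^ m \<longleftrightarrow> m \<le> multiplicity (int p) x"
    using p1 by (simp add: divide_le_cancel frac_le_eq power_increasing_iff field_simps)
  also have "\<dots> \<longleftrightarrow> int p ^ m dvd x"
    using False p1 by (simp add: power_dvd_iff_le_multiplicity)
  finally show ?thesis .
qed simp

lemma rat_padic_abs_of_int_le_1: "prime p \<Longrightarrow> rat_padic_abs p (of_int x) \<le> 1"
  using rat_padic_abs_of_int_le_iff[of p x 0] by simp

text \<open>The power of \<open>p\<close> dividing \<open>x\<close> is at most \<open>|x|\<close>.
  In the final argument this excludes pairs with a zero entry.\<close>

lemma rat_padic_abs_of_int_ge:
  assumes p: "prime p" and x: "x \<noteq> 0"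
  shows "rat_padic_abs p (of_int x) \<ge> 1 / of_int \<bar>x\<bar>"
proof -
  have p0: "real p > 0" using p prime_gt_0_nat[of p] by simp
  have "int p ^ multiplicity (int p) x \<le> \<bar>x\<bar>"
    using x by (intro zdvd_imp_le) (auto simp: multiplicity_dvd)
  hence "real_of_int (int p ^ multiplicity (int p) x) \<le> of_int \<bar>x\<bar>" by (simp only: of_int_le_iff)
  hence "1 / of_int \<bar>x\<bar> \<le> 1 / real p ^ multiplicity (int p) x"
    using p0 by (intro divide_left_mono) (auto simp: x)
  thus ?thesis
    using rat_padic_abs_frac[OF p x, of 1] by (simp add: power_int_minus divide_inverse)
qed

text \<open>The denominator of \<open>S\<close> is prime to \<open>p\<close>, hence invertible
  modulo \<open>p^m\<close>; the numerator times such an inverse is the required integer.\<close>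

lemma padic_integer_approx:
  assumes p: "prime p" and S: "rat_padic_abs p S \<le> 1"
  obtains d :: int where "rat_padic_abs p (S - of_int d) \<le> 1 / real p ^ m"
proof -
  obtain a b where ab: "quotient_of S = (a, b)" by fastforce
  have b: "b > 0" "S = of_int a / of_int b" "coprime a b"
    using quotient_of_denom_pos[OF ab] quotient_of_div[OF ab] quotient_of_coprime[OF ab] by auto
  have pp: "prime (int p)" and p1: "real p > 1" using p prime_gt_1_nat[of p] by auto
  have nb: "\<not> int p dvd b"
  proof
    assume pb: "int p dvd b"
    hence pa: "\<not> int p dvd a" using b(3) pp by (metis coprime_common_divisor not_prime_unit)
    hence a0: "a \<noteq> 0" by auto
    have "multiplicity (int p) b \<ge> 1"
      using pb b pp by (simp add: multiplicity_gt_zero_iff Suc_le_eq prime_multiplicity_gt_zero_iff)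
    hence "real p ^ multiplicity (int p) b > 1" using p1 by (intro one_less_power) auto
    moreover have "rat_padic_abs p S = real p ^ multiplicity (int p) b"
      unfolding b(2) using rat_padic_abs_frac[OF p a0, of b] b(1) pa
      by (simp add: not_dvd_imp_multiplicity_0)
    ultimately show False using S by simp
  qed
  have "coprime (int p) b" using nb pp by (simp add: prime_imp_coprime)
  hence "coprime b (int p ^ m)" by (simp add: coprime_commute)
  then obtain u where u: "[b * u = 1] (mod (int p ^ m))" using cong_solve_coprime_int by blast
  have "[a * (b * u) = a * 1] (mod (int p ^ m))" using u by (rule cong_scalar_left)
  hence dv: "int p ^ m dvd a - b * (a * u)"
    by (simp add: cong_iff_dvd_diff dvd_diff_commute mult_ac)
  have "rat_padic_abs p (of_int b) = 1"
    using rat_padic_abs_frac[OF p, of b 1] b(1) nb by (simp add: not_dvd_imp_multiplicity_0)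
  moreover have "of_int b * (S - of_int (a * u)) = of_int (a - b * (a * u))"
    using b by (simp add: field_simps)
  ultimately have "rat_padic_abs p (S - of_int (a * u)) = rat_padic_abs p (of_int (a - b * (a * u)))"
    by (metis mult_1 rat_padic_abs_mult[OF p])
  also have "\<dots> \<le> 1 / real p ^ m" using dv rat_padic_abs_of_int_le_iff[OF p] by blast
  finally show ?thesis by (rule that)
qed

section \<open>Polynomials and linear forms on classes of Cauchy sequences\<close>

abbreviation Qp_class :: "nat \<Rightarrow> (nat \<Rightarrow> rat) \<Rightarrow> (nat \<Rightarrow> rat) set" where
  "Qp_class p s \<equiv> padic_null p +>\<^bsub>padic_Cauchy_ring p\<^esub> s"

lemma padic_Cauchy_ring_pow:
  "s [^]\<^bsub>padic_Cauchy_ring p\<^esub> (i :: nat) = (\<lambda>n. s n ^ i)"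
  by (induction i) (auto simp: nat_pow_def mult.commute)

lemma padic_Cauchy_power: "prime p \<Longrightarrow> padic_Cauchy p s \<Longrightarrow> padic_Cauchy p (\<lambda>n. s n ^ i)"
  by (induction i) (auto simp: padic_Cauchy_const padic_Cauchy_mult)

lemma padic_Cauchy_ring_finsum:
  assumes p: "prime p" and A: "finite A" and f: "\<And>i. i \<in> A \<Longrightarrow> padic_Cauchy p (f i)"
  shows "finsum (padic_Cauchy_ring p) f A = (\<lambda>n. \<Sum>i\<in>A. f i n)"
proof -
  interpret cring "padic_Cauchy_ring p" using p by (rule cring_padic_Cauchy_ring)
  show ?thesis using A f
    by (induction A rule: finite_induct) (auto simp: finsum_insert Pi_def)
qed

lemma padic_Cauchy_poly:
  assumes p: "prime p" and s: "padic_Cauchy p s"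
  shows "padic_Cauchy p (\<lambda>n. poly g (s n))"
proof (induction g)
  case 0 show ?case by (simp add: padic_Cauchy_const)
next
  case (pCons a g)
  thus ?case by (simp add: padic_Cauchy_const padic_Cauchy_add[OF p] padic_Cauchy_mult[OF p s])
qed

lemma Qp_class_hom:
  "prime p \<Longrightarrow> ring_hom_cring (padic_Cauchy_ring p) (Qp p) (Qp_class p)"
  unfolding Qp_def by (intro ideal.rcos_ring_hom_cring ideal_padic_null cring_padic_Cauchy_ring)

text \<open>\<open>Qp_class p\<close> is a ring homomorphism on Cauchy sequences, so polynomial
  equations in \<open>Qp p\<close> can be tested termwise on a representative.\<close>

lemma Qp_poly_Qp_class:
  assumes p: "prime p" and s: "padic_Cauchy p s"
  shows "Qp_poly p g (Qp_class p s) = Qp_class p (\<lambda>n. poly g (s n))"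
proof -
  let ?R = "padic_Cauchy_ring p"
  interpret h: ring_hom_cring ?R "Qp p" "Qp_class p" using p by (rule Qp_class_hom)
  let ?f = "\<lambda>i n. coeff g i * s n ^ i"
  have c: "padic_Cauchy p (?f i)" for i
    by (intro padic_Cauchy_mult p padic_Cauchy_const padic_Cauchy_power s)
  have pow: "Qp_class p (s [^]\<^bsub>?R\<^esub> i) = Qp_class p s [^]\<^bsub>Qp p\<^esub> i" for i :: nat
  proof (induction i)
    case (Suc i)
    have "Qp_class p (s [^]\<^bsub>?R\<^esub> Suc i) = Qp_class p (s [^]\<^bsub>?R\<^esub> i) \<otimes>\<^bsub>Qp p\<^esub> Qp_class p s"
      unfolding h.R.nat_pow_Suc
      by (rule h.hom_mult) (auto simp: padic_Cauchy_ring_pow padic_Cauchy_power p s)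
    thus ?case by (simp add: Suc)
  qed (simp del: padic_Cauchy_ring_simps)
  have "Qp_class p (finsum ?R ?f {..degree g}) = finsum (Qp p) (Qp_class p \<circ> ?f) {..degree g}"
    by (rule h.hom_finsum) (simp add: c)
  also have "(Qp_class p \<circ> ?f) = (\<lambda>i. Qp_of_rat p (coeff g i) \<otimes>\<^bsub>Qp p\<^esub> Qp_class p s [^]\<^bsub>Qp p\<^esub> i)"
  proof
    fix i
    have "Qp_class p (?f i) = Qp_class p ((\<lambda>n. coeff g i) \<otimes>\<^bsub>?R\<^esub> s [^]\<^bsub>?R\<^esub> i)"
      by (simp add: padic_Cauchy_ring_pow)
    also have "\<dots> = Qp_class p (\<lambda>n. coeff g i) \<otimes>\<^bsub>Qp p\<^esub> Qp_class p (s [^]\<^bsub>?R\<^esub> i)"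
      by (rule h.hom_mult) (auto simp: padic_Cauchy_const padic_Cauchy_ring_pow padic_Cauchy_power p s)
    also have "Qp_class p (s [^]\<^bsub>?R\<^esub> i) = Qp_class p s [^]\<^bsub>Qp p\<^esub> i"
      by (rule pow)
    finally show "(Qp_class p \<circ> ?f) i = Qp_of_rat p (coeff g i) \<otimes>\<^bsub>Qp p\<^esub> Qp_class p s [^]\<^bsub>Qp p\<^esub> i"
      by (simp add: Qp_of_rat_def)
  qed
  finally show ?thesis
    using c by (simp add: Qp_poly_def padic_Cauchy_ring_finsum[OF p] poly_altdef)
qed

lemma Qp_class_eq_zeroD:
  assumes p: "prime p" and s: "padic_Cauchy p s" and "Qp_class p s = \<zero>\<^bsub>Qp p\<^esub>"
  shows "s \<in> padic_null p"
proof -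
  have "\<zero>\<^bsub>Qp p\<^esub> = padic_null p" by (simp add: Qp_def FactRing_def)
  moreover have "s \<in> Qp_class p s" using mem_Qp_coset[OF p s, of s] by (simp add: padic_null_def)
  ultimately show ?thesis using assms by simp
qed

lemma Qp_linear_form_eq:
  assumes p: "prime p" and s: "padic_Cauchy p s"
  shows "Qp_of_rat p x \<otimes>\<^bsub>Qp p\<^esub> Qp_class p s \<ominus>\<^bsub>Qp p\<^esub> Qp_of_rat p y = Qp_class p (\<lambda>n. x * s n - y)"
proof -
  let ?R = "padic_Cauchy_ring p"
  interpret h: ring_hom_cring ?R "Qp p" "Qp_class p" using p by (rule Qp_class_hom)
  have [simp]: "padic_Cauchy p (\<lambda>n. x)" "padic_Cauchy p (\<lambda>n. y)" "padic_Cauchy p (\<lambda>n. x * s n)"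
    by (auto intro: padic_Cauchy_const padic_Cauchy_mult p s)
  have "Qp_class p (\<lambda>n. x * s n - y) = Qp_class p (((\<lambda>n. x) \<otimes>\<^bsub>?R\<^esub> s) \<oplus>\<^bsub>?R\<^esub> (\<ominus>\<^bsub>?R\<^esub> (\<lambda>n. y)))"
    by (simp add: padic_Cauchy_ring_minus[OF p])
  also have "\<dots> = (Qp_class p (\<lambda>n. x) \<otimes>\<^bsub>Qp p\<^esub> Qp_class p s) \<oplus>\<^bsub>Qp p\<^esub> (\<ominus>\<^bsub>Qp p\<^esub> Qp_class p (\<lambda>n. y))"
    using s by (subst h.hom_add) (auto simp: padic_Cauchy_ring_minus[OF p] padic_Cauchy_minus simp flip: h.hom_mult h.hom_a_inv)
  finally show ?thesis by (simp add: Qp_of_rat_def a_minus_def)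
qed

lemma Qp_abs_linear_form_LIMSEQ:
  assumes p: "prime p" and s: "padic_Cauchy p s"
  shows "(\<lambda>n. rat_padic_abs p (x * s n - y)) \<longlonglongrightarrow>
    Qp_abs p (Qp_of_rat p x \<otimes>\<^bsub>Qp p\<^esub> Qp_class p s \<ominus>\<^bsub>Qp p\<^esub> Qp_of_rat p y)"
proof -
  have "padic_Cauchy p (\<lambda>n. x * s n + (- y))"
    by (intro padic_Cauchy_add padic_Cauchy_mult padic_Cauchy_const p s)
  thus ?thesis unfolding Qp_linear_form_eq[OF assms] using Qp_abs_coset[OF p] by simp
qed

lemma poly_map_poly_of_rat_mult:
  fixes x :: "'a :: field_char_0"
  shows "poly (map_poly of_rat (q * r)) x = poly (map_poly of_rat q) x * poly (map_poly of_rat r) x"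
proof -
  have add: "poly (map_poly of_rat (q + r)) x = poly (map_poly of_rat q) x + poly (map_poly of_rat r) x"
    for q r :: "rat poly"
    by (induction q r rule: poly_induct2) (simp_all add: map_poly_pCons of_rat_add algebra_simps)
  show ?thesis
  proof (induction q)
    case (pCons c q)
    have "poly (map_poly of_rat (smult c r)) x = of_rat c * poly (map_poly of_rat r) x"
      by (simp add: map_poly_smult of_rat_mult)
    thus ?case using pCons by (simp add: add map_poly_pCons algebra_simps)
  qed simp
qed

lemma irreducible_quadratic_no_root:
  fixes g :: "'a :: field poly"
  assumes "irreducible g" "degree g = 2"
  shows "poly g x \<noteq> 0"
proof
  assume "poly g x = 0"
  then obtain h where h: "g = [:- x, 1:] * h" by (auto simp: poly_eq_0_iff_dvd elim: dvdE)
  hence h0: "h \<noteq> 0" using assms by auto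
  hence "degree g = 1 + degree h" unfolding h by (subst degree_mult_eq) auto
  hence "degree h = 1" using assms by simp
  moreover have "is_unit [:- x, 1:] \<or> is_unit h" using assms(1) h by (rule irreducibleD)
  ultimately show False by (auto simp: is_unit_iff_degree h0)
qed

text \<open>Otherwise \<open>g\<close> and \<open>f\<close> are coprime, and a Bezout identity would
  make the constant sequence 1 null.\<close>

lemma Qp_minimal_polynomial_dvd:
  fixes g f :: "rat poly"
  assumes p: "prime p" and s: "padic_Cauchy p s" and g: "irreducible g"
    and null: "(\<lambda>n. poly g (s n)) \<in> padic_null p" "(\<lambda>n. poly f (s n)) \<in> padic_null p"
  shows "g dvd f"
proof (rule ccontr)
  assume "\<not> g dvd f"
  hence "coprime g f" using g by (intro prime_elem_imp_coprime irreducible_imp_prime_elem_gcd)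
  hence "gcd g f = 1" by (simp add: coprime_iff_gcd_eq_1)
  then obtain u v where uv: "u * g + v * f = 1" using bezout_coefficients_fst_snd[of g f] by metis
  have "(\<lambda>n. poly u (s n) * poly g (s n) + poly v (s n) * poly f (s n)) \<in> padic_null p"
    by (intro padic_null_add padic_null_mult padic_Cauchy_poly p s null)
  also have "(\<lambda>n. poly u (s n) * poly g (s n) + poly v (s n) * poly f (s n)) = (\<lambda>n. 1)"
    using uv by (metis poly_1 poly_add poly_mult)
  finally show False by (simp add: padic_null_def LIMSEQ_const_iff)
qed

text \<open>The squares tend to an integer, so the terms of \<open>S\<close> eventually have
  absolute value at most 1 and can be approximated by integers to every precision
  \<open>p^i\<close>. These integers inherit coherence and the equation modulo \<open>p^i\<close>
  from \<open>S\<close>.\<close>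

lemma padic_integer_sqrt_sequence:
  fixes D :: int
  assumes p: "prime p" and S: "padic_Cauchy p S" and null: "(\<lambda>k. (S k)\<^sup>2 - of_int D) \<in> padic_null p"
  obtains d :: "nat \<Rightarrow> int" where "\<And>i. \<forall>\<^sub>F k in sequentially. rat_padic_abs p (S k - of_int (d i)) \<le> 1 / real p ^ i"
    "\<And>i. int p ^ i dvd (d i)\<^sup>2 - D" "\<And>i. int p ^ i dvd d (Suc i) - d i"
proof -
  have p0: "real p > 1" using p prime_gt_1_nat[of p] by simp
  have small: "\<forall>\<^sub>F k in sequentially. rat_padic_abs p ((S k)\<^sup>2 - of_int D) \<le> 1 / real p ^ i" for i
    using padic_nullD[OF null, of "1 / real p ^ i"] p0
    by (metis (no_types, lifting) eventually_sequentiallyI less_imp_le zero_less_divide_1_iff zero_less_power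
        dual_order.strict_trans zero_less_one)
  have add: "rat_padic_abs p (x + y) \<le> e" if "rat_padic_abs p x \<le> e" "rat_padic_abs p y \<le> e" for x y e
    using rat_padic_abs_add[OF p, of x y] that by linarith
  have ex: "\<exists>d. \<forall>\<^sub>F k in sequentially. rat_padic_abs p (S k) \<le> 1 \<and>
      rat_padic_abs p (S k - of_int d) \<le> 1 / real p ^ i" for i
  proof -
    obtain N where N: "\<And>m n. m \<ge> N \<Longrightarrow> n \<ge> N \<Longrightarrow> rat_padic_abs p (S m - S n) < 1 / real p ^ i"
      using padic_CauchyD[OF S, of "1 / real p ^ i"] p0 by auto
    obtain N' where N': "\<And>k. k \<ge> N' \<Longrightarrow> rat_padic_abs p ((S k)\<^sup>2 - of_int D) \<le> 1"
      using small[of 0] by (auto simp: eventually_sequentially)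
    have le1: "rat_padic_abs p (S k) \<le> 1" if "k \<ge> N'" for k
    proof -
      have "rat_padic_abs p (((S k)\<^sup>2 - of_int D) + of_int D) \<le> 1"
        by (intro add N' that rat_padic_abs_of_int_le_1 p)
      hence "(rat_padic_abs p (S k))\<^sup>2 \<le> 1" by (simp add: power2_eq_square rat_padic_abs_mult[OF p])
      thus ?thesis by (simp add: abs_square_le_1 abs_le_iff)
    qed
    define K where "K = max N N'"
    obtain d where d: "rat_padic_abs p (S K - of_int d) \<le> 1 / real p ^ i"
      using padic_integer_approx[OF p le1[of K]] by (auto simp: K_def)
    have "rat_padic_abs p (S k) \<le> 1 \<and> rat_padic_abs p (S k - of_int d) \<le> 1 / real p ^ i" if "k \<ge> K" for k
    proof -
      have "rat_padic_abs p ((S k - S K) + (S K - of_int d)) \<le> 1 / real p ^ i"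
        using N[of k K] that d by (intro add) (auto simp: K_def less_imp_le)
      thus ?thesis using le1[of k] that by (simp add: K_def)
    qed
    thus ?thesis by (intro exI[of _ d] eventually_sequentiallyI[of K]) blast
  qed
  then obtain d where d: "\<And>i. \<forall>\<^sub>F k in sequentially. rat_padic_abs p (S k) \<le> 1 \<and>
      rat_padic_abs p (S k - of_int (d i)) \<le> 1 / real p ^ i" by metis
  have dc: "rat_padic_abs p (of_int (d i) - S k) = rat_padic_abs p (S k - of_int (d i))" for i k
    by (rule rat_padic_abs_diff_commute)
  show ?thesis
  proof
    fix i
    show "\<forall>\<^sub>F k in sequentially. rat_padic_abs p (S k - of_int (d i)) \<le> 1 / real p ^ i"
      using d[of i] by (rule eventually_mono) simp
    \<comment> \<open>The divisibility does not involve \<open>k\<close>, so it is enough to have it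
      for some large \<open>k\<close>.\<close>
    have "\<forall>\<^sub>F k in sequentially. int p ^ i dvd (d i)\<^sup>2 - D"
      using d[of i] small[of i]
    proof eventually_elim
      case (elim k)
      have "rat_padic_abs p ((of_int (d i) - S k) * (of_int (d i) + S k)) \<le> 1 / real p ^ i * 1"
        unfolding rat_padic_abs_mult[OF p] dc
        using elim p0 by (intro mult_mono add rat_padic_abs_of_int_le_1 p) (auto simp: rat_padic_abs_nonneg)
      hence "rat_padic_abs p ((of_int (d i) - S k) * (of_int (d i) + S k) + ((S k)\<^sup>2 - of_int D)) \<le> 1 / real p ^ i"
        using elim by (intro add) auto
      also have "(of_int (d i) - S k) * (of_int (d i) + S k) + ((S k)\<^sup>2 - of_int D) = of_int ((d i)\<^sup>2 - D)"
        by (simp add: algebra_simps power2_eq_square)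
      finally show ?case using rat_padic_abs_of_int_le_iff[OF p] by blast
    qed
    thus "int p ^ i dvd (d i)\<^sup>2 - D" by simp
    have "\<forall>\<^sub>F k in sequentially. int p ^ i dvd d (Suc i) - d i"
      using d[of i] d[of "Suc i"]
    proof eventually_elim
      case (elim k)
      have "1 / real p ^ Suc i \<le> 1 / real p ^ i"
        using p0 by (intro divide_left_mono power_increasing) auto
      hence "rat_padic_abs p ((of_int (d (Suc i)) - S k) + (S k - of_int (d i))) \<le> 1 / real p ^ i"
        using elim by (intro add) (auto simp: dc simp del: power_Suc)
      also have "(of_int (d (Suc i)) - S k) + (S k - of_int (d i)) = of_int (d (Suc i) - d i)" by simp
      finally show ?case using rat_padic_abs_of_int_le_iff[OF p] by blast
    qed
    thus "int p ^ i dvd d (Suc i) - d i" by simp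
  qed
qed

text \<open>If \<open>A X^2 + B X + C\<close> is the minimal polynomial with denominators cleared
  and \<open>s\<close> represents \<open>\<beta>\<close>, then \<open>2 A \<beta> + B\<close> is a
  square root of the discriminant \<open>D\<close>. So \<open>good_approx_sqrt\<close> applies, and
  \<open>good_approx_linear\<close> carries the result back.\<close>

lemma Qp_quadratic_good_approx:
  fixes f :: "int poly"
  assumes p: "prime p" and s: "padic_Cauchy p s"
    and alg: "Qp_algebraic_of_degree p 2 (Qp_class p s)"
    and f: "Qp_poly p (map_poly of_int f) (Qp_class p s) = \<zero>\<^bsub>Qp p\<^esub>"
    and \<alpha>: "poly (map_poly real_of_int f) \<alpha> \<noteq> 0"
  shows "good_approx (\<lambda>Q R w. Qp_abs p (Qp_of_rat p (of_int Q) \<otimes>\<^bsub>Qp p\<^esub> Qp_class p s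
      \<ominus>\<^bsub>Qp p\<^esub> Qp_of_rat p (of_int R)) \<le> w) \<alpha>"
proof -
  obtain g :: "rat poly" where g: "irreducible g" "lead_coeff g = 1" "degree g = 2"
    and gz: "Qp_poly p g (Qp_class p s) = \<zero>\<^bsub>Qp p\<^esub>"
    using alg unfolding Qp_algebraic_of_degree_def by blast
  have gn: "(\<lambda>n. poly g (s n)) \<in> padic_null p"
    and fn: "(\<lambda>n. poly (map_poly of_int f) (s n)) \<in> padic_null p"
    using gz f unfolding Qp_poly_Qp_class[OF p s]
    by (auto intro: Qp_class_eq_zeroD[OF p padic_Cauchy_poly[OF p s]])
  obtain h where h: "map_poly of_int f = g * h"
    using Qp_minimal_polynomial_dvd[OF p s g(1) gn fn] by (auto elim: dvdE)
  have "map_poly real_of_int f = map_poly of_rat (map_poly of_int f)"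
    by (simp add: map_poly_map_poly o_def)
  \<comment> \<open>\<open>g\<close> divides \<open>f\<close>, so a real zero of \<open>g\<close>
    would be a zero of \<open>f\<close>.\<close>
  hence g\<alpha>: "poly (map_poly of_rat g) \<alpha> \<noteq> 0"
    using \<alpha> unfolding h by (simp add: poly_map_poly_of_rat_mult)
  have g2: "coeff g 2 = 1" using g by simp
  have gx: "poly g x = x\<^sup>2 + coeff g 1 * x + coeff g 0" for x
    using g2 unfolding poly_altdef g(3) by (simp add: numeral_2_eq_2)
  have dg: "degree (map_poly real_of_rat g) = 2" using g(3) by (simp add: degree_map_poly)
  have gr: "poly (map_poly of_rat g) x = x\<^sup>2 + of_rat (coeff g 1) * x + of_rat (coeff g 0)" for x :: real
    using g2 unfolding poly_altdef dg by (simp add: numeral_2_eq_2 coeff_map_poly)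
  obtain b1 b2 where b: "b2 \<noteq> 0" "coeff g 1 = of_int b1 / of_int b2" by (rule rat_as_frac)
  obtain c1 c2 where c: "c2 \<noteq> 0" "coeff g 0 = of_int c1 / of_int c2" by (rule rat_as_frac)
  define A B C where ABC: "A = b2 * c2" "B = b1 * c2" "C = c1 * b2"
  have A0: "A \<noteq> 0" using b c by (simp add: ABC)
  have BA: "coeff g 1 = of_int B / of_int A" and CA: "coeff g 0 = of_int C / of_int A"
    using b c by (auto simp: ABC)
  define D where "D = B\<^sup>2 - 4 * A * C"
  have sq: "(2 * of_int A * x + of_int B)\<^sup>2 - of_int D = (2 * of_int A)\<^sup>2 * poly g x" for x
    using A0 unfolding gx BA CA D_def by (simp add: field_simps power2_eq_square)
  have sqr: "(2 * of_int A * x + of_int B)\<^sup>2 - of_int D = (2 * of_int A)\<^sup>2 * poly (map_poly of_rat g) x"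
    for x :: real
    using A0 unfolding gr BA CA D_def by (simp add: of_rat_divide field_simps power2_eq_square)
  define S where "S = (\<lambda>n. 2 * of_int A * s n + of_int B)"
  have SC: "padic_Cauchy p S" unfolding S_def
    by (intro padic_Cauchy_add padic_Cauchy_mult padic_Cauchy_const p s)
  have "(\<lambda>k. (S k)\<^sup>2 - of_int D) \<in> padic_null p"
    unfolding S_def sq by (intro padic_null_mult padic_Cauchy_const p gn)
  then obtain d where d: "\<And>i. \<forall>\<^sub>F k in sequentially. rat_padic_abs p (S k - of_int (d i)) \<le> 1 / real p ^ i"
    "\<And>i. int p ^ i dvd (d i)\<^sup>2 - D" "\<And>i. int p ^ i dvd d (Suc i) - d i"
    using padic_integer_sqrt_sequence[OF p SC] by blast
  \<comment> \<open>A rational square root of \<open>D\<close> would give \<open>g\<close> a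
    rational zero.\<close>
  have nonsq: "y = 0" if xy: "x\<^sup>2 = D * y\<^sup>2" for x y :: int
  proof (rule ccontr)
    assume y: "y \<noteq> 0"
    define q :: rat where "q = (of_int x / of_int y - of_int B) / (2 * of_int A)"
    have "2 * of_int A * q + of_int B = of_int x / of_int y" using A0 by (simp add: q_def)
    moreover have "(of_int x)\<^sup>2 = (of_int D * (of_int y)\<^sup>2 :: rat)"
      using xy by (metis of_int_mult of_int_power)
    ultimately have "(2 * of_int A)\<^sup>2 * poly g q = 0"
      unfolding sq[symmetric] using y by (simp add: power_divide)
    hence "poly g q = 0" using A0 by simp
    thus False using irreducible_quadratic_no_root[OF g(1,3)] by blast
  qed
  have "(2 * of_int A * \<alpha> + of_int B)\<^sup>2 \<noteq> of_int D" using sqr[of \<alpha>] g\<alpha> A0 by auto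
  from good_approx_sqrt[OF p d(2,3) nonsq this] show ?thesis
  proof (rule good_approx_linear[where m = "2 * A" and b = "- B" and k = 1])
    fix u v w assume "padic_dist_le p d u v w"
    then obtain m where m: "w = 1 / real p ^ m" "int p ^ m dvd u * d m - v"
      by (auto simp: padic_dist_le_def)
    let ?x = "of_int (2 * A * u) :: rat" and ?y = "of_int (- B * u + 1 * v) :: rat"
    have "\<forall>\<^sub>F k in sequentially. rat_padic_abs p (?x * s k - ?y) \<le> w"
      using d(1)[of m]
    proof (rule eventually_mono)
      fix k assume k: "rat_padic_abs p (S k - of_int (d m)) \<le> 1 / real p ^ m"
      have eq: "?x * s k - ?y = of_int u * (S k - of_int (d m)) + of_int (u * d m - v)"
        by (simp add: S_def algebra_simps)
      have "rat_padic_abs p (of_int u * (S k - of_int (d m))) \<le> 1 * w"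
        unfolding rat_padic_abs_mult[OF p] m(1)
        by (intro mult_mono k rat_padic_abs_of_int_le_1 p) (auto simp: rat_padic_abs_nonneg)
      moreover have "rat_padic_abs p (of_int (u * d m - v)) \<le> w"
        unfolding m(1) using m(2) rat_padic_abs_of_int_le_iff[OF p] by blast
      ultimately show "rat_padic_abs p (?x * s k - ?y) \<le> w"
        unfolding eq
        using rat_padic_abs_add[OF p, of "of_int u * (S k - of_int (d m))" "of_int (u * d m - v)"]
        by linarith
    qed
    hence "Qp_abs p (Qp_of_rat p ?x \<otimes>\<^bsub>Qp p\<^esub> Qp_class p s \<ominus>\<^bsub>Qp p\<^esub> Qp_of_rat p ?y) \<le> w"
      by (intro tendsto_upperbound[OF Qp_abs_linear_form_LIMSEQ[OF p s]]) auto
    thus "0 \<le> w \<and> Qp_abs p (Qp_of_rat p ?x \<otimes>\<^bsub>Qp p\<^esub> Qp_class p s \<ominus>\<^bsub>Qp p\<^esub> Qp_of_rat p ?y) \<le> w"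
      using m(1) by simp
  qed (use A0 in auto)
qed

text \<open>Otherwise the quadratic \<open>g\<close> would divide \<open>X\<close>. The p-adic
  absolute value of \<open>\<beta>\<close> thus has a positive lower bound, which handles pairs with
  second entry 0.\<close>

lemma Qp_algebraic_imp_not_null:
  assumes p: "prime p" and s: "padic_Cauchy p s"
    and alg: "Qp_algebraic_of_degree p 2 (Qp_class p s)"
  shows "s \<notin> padic_null p"
proof
  assume sn: "s \<in> padic_null p"
  obtain g :: "rat poly" where g: "irreducible g" "degree g = 2"
    and gz: "Qp_poly p g (Qp_class p s) = \<zero>\<^bsub>Qp p\<^esub>"
    using alg unfolding Qp_algebraic_of_degree_def by blast
  have gn: "(\<lambda>n. poly g (s n)) \<in> padic_null p"
    using gz unfolding Qp_poly_Qp_class[OF p s]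
    by (rule Qp_class_eq_zeroD[OF p padic_Cauchy_poly[OF p s]])
  have "g dvd [:0, 1:]"
    by (rule Qp_minimal_polynomial_dvd[OF p s g(1) gn]) (use sn in simp)
  hence "degree g \<le> degree [:0, 1 :: rat:]" by (rule dvd_imp_degree_le) simp
  thus False using g by simp
qed

section \<open>Deducing the infimum and the liminf\<close>

theorem theorem1p1:
  fixes p :: nat and \<beta> :: "(nat \<Rightarrow> rat) set" and f :: "int poly" and \<alpha> :: real
  assumes "prime p"
    and "\<beta> \<in> carrier (Qp p)"
    and "Qp_algebraic_of_degree p 2 \<beta>"
    and "irreducible f"
    and "Qp_poly p (map_poly of_int f) \<beta> = \<zero>\<^bsub>Qp p\<^esub>"
    and "poly (map_poly real_of_int f) \<alpha> \<noteq> 0"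
  shows
    "(INF (q, r) \<in> {(q :: int, r :: int). q * r \<noteq> 0}.
        real_of_int (max \<bar>q\<bar> \<bar>r\<bar>) * \<bar>of_int q * \<alpha> - of_int r\<bar>
        * Qp_abs p (Qp_of_rat p (of_int q) \<otimes>\<^bsub>Qp p\<^esub> \<beta> \<ominus>\<^bsub>Qp p\<^esub> Qp_of_rat p (of_int r))) = 0
     \<and> Liminf (filtercomap (\<lambda>(Q :: int, R :: int). max \<bar>Q\<bar> \<bar>R\<bar>) at_top)
        (\<lambda>(Q, R). ereal (real_of_int (max \<bar>Q\<bar> \<bar>R\<bar>) * ln (real_of_int (max \<bar>Q\<bar> \<bar>R\<bar>))
          * \<bar>of_int Q * \<alpha> - of_int R\<bar>
          * Qp_abs p (Qp_of_rat p (of_int Q) \<otimes>\<^bsub>Qp p\<^esub> \<beta> \<ominus>\<^bsub>Qp p\<^esub> Qp_of_rat p (of_int R)))) < \<infinity>"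
proof -
  note p = assms(1)
  obtain s where s: "padic_Cauchy p s" and \<beta>: "\<beta> = Qp_class p s"
    using assms(2) unfolding carrier_Qp by blast
  define X where "X = (\<lambda>Q R :: int. Qp_abs p (Qp_of_rat p (of_int Q) \<otimes>\<^bsub>Qp p\<^esub> \<beta>
      \<ominus>\<^bsub>Qp p\<^esub> Qp_of_rat p (of_int R)))"
  define M where "M = (\<lambda>Q R :: int. real_of_int (max \<bar>Q\<bar> \<bar>R\<bar>))"
  have lim: "(\<lambda>n. rat_padic_abs p (of_int Q * s n - of_int R)) \<longlonglongrightarrow> X Q R" for Q R
    unfolding X_def \<beta> by (rule Qp_abs_linear_form_LIMSEQ[OF p s])
  have X0: "X Q R \<ge> 0" for Q R
    by (rule tendsto_lowerbound[OF lim]) (auto simp: rat_padic_abs_nonneg)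
  have "good_approx (\<lambda>Q R w. X Q R \<le> w) \<alpha>"
    using Qp_quadratic_good_approx[OF p s] assms(3,5,6) unfolding X_def \<beta> by blast
  then obtain C where C: "C > 0" and ex: "\<And>N :: nat. \<exists>Q R w.
     int N \<le> max \<bar>Q\<bar> \<bar>R\<bar> \<and> X Q R \<le> w \<and> (M Q R)\<^sup>2 * w \<le> C \<and>
     \<bar>of_int Q * \<alpha> - of_int R\<bar> * ln (M Q R) \<le> C * M Q R"
    unfolding good_approx_def M_def by blast
  \<comment> \<open>The p-adic bound has order \<open>1 / M^2\<close> and the real one order
    \<open>M / ln M\<close>; their product is what keeps the liminf expression bounded.\<close>
  have approx: "\<exists>Q R. int N \<le> max \<bar>Q\<bar> \<bar>R\<bar> \<and> (M Q R)\<^sup>2 * X Q R \<le> C \<and>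
     M Q R * ln (M Q R) * \<bar>of_int Q * \<alpha> - of_int R\<bar> * X Q R \<le> C\<^sup>2" for N :: nat
  proof -
    obtain Q R w where QR: "int N \<le> max \<bar>Q\<bar> \<bar>R\<bar>" "X Q R \<le> w" "(M Q R)\<^sup>2 * w \<le> C"
      "\<bar>of_int Q * \<alpha> - of_int R\<bar> * ln (M Q R) \<le> C * M Q R" using ex by blast
    have M0: "M Q R \<ge> 0" by (simp add: M_def)
    have "(M Q R)\<^sup>2 * X Q R \<le> (M Q R)\<^sup>2 * w" using QR by (intro mult_left_mono) auto
    hence 1: "(M Q R)\<^sup>2 * X Q R \<le> C" using QR by linarith
    have "M Q R * ln (M Q R) * \<bar>of_int Q * \<alpha> - of_int R\<bar> * X Q R
        = M Q R * X Q R * (\<bar>of_int Q * \<alpha> - of_int R\<bar> * ln (M Q R))" by simp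
    also have "\<dots> \<le> M Q R * X Q R * (C * M Q R)"
      using QR M0 X0 by (intro mult_left_mono) auto
    also have "\<dots> = C * ((M Q R)\<^sup>2 * X Q R)" by (simp add: power2_eq_square)
    also have "\<dots> \<le> C * C" using 1 C by (intro mult_left_mono) auto
    finally show ?thesis using QR 1 by (auto simp: power2_eq_square)
  qed
  have "Liminf (filtercomap (\<lambda>(Q :: int, R :: int). max \<bar>Q\<bar> \<bar>R\<bar>) at_top)
        (\<lambda>(Q, R). ereal (M Q R * ln (M Q R) * \<bar>of_int Q * \<alpha> - of_int R\<bar> * X Q R)) \<le> ereal (C\<^sup>2)"
  proof (rule ccontr)
    assume "\<not> ?thesis"
    hence "\<forall>\<^sub>F z in filtercomap (\<lambda>(Q :: int, R :: int). max \<bar>Q\<bar> \<bar>R\<bar>) at_top.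
        ereal (C\<^sup>2) < (\<lambda>(Q, R). ereal (M Q R * ln (M Q R) * \<bar>of_int Q * \<alpha> - of_int R\<bar> * X Q R)) z"
      by (intro less_LiminfD) (simp add: not_le)
    then obtain N where N: "\<And>Q R :: int. N \<le> max \<bar>Q\<bar> \<bar>R\<bar> \<Longrightarrow>
        C\<^sup>2 < M Q R * ln (M Q R) * \<bar>of_int Q * \<alpha> - of_int R\<bar> * X Q R"
      unfolding eventually_filtercomap_at_top_linorder by auto
    obtain Q R where "int (nat N) \<le> max \<bar>Q\<bar> \<bar>R\<bar>"
      "M Q R * ln (M Q R) * \<bar>of_int Q * \<alpha> - of_int R\<bar> * X Q R \<le> C\<^sup>2" using approx by blast
    moreover from this(1) have "N \<le> max \<bar>Q\<bar> \<bar>R\<bar>" by linarith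
    ultimately show False using N[of Q R] by linarith
  qed
  hence second: "Liminf (filtercomap (\<lambda>(Q :: int, R :: int). max \<bar>Q\<bar> \<bar>R\<bar>) at_top)
        (\<lambda>(Q, R). ereal (M Q R * ln (M Q R) * \<bar>of_int Q * \<alpha> - of_int R\<bar> * X Q R)) < \<infinity>"
    by (rule le_less_trans) simp
  obtain e where e: "e > 0" and lo: "\<forall>\<^sub>F n in sequentially. e \<le> rat_padic_abs p (s n)"
    using padic_not_null_bounded_below[OF p s] Qp_algebraic_imp_not_null[OF p s] assms(3)
    unfolding \<beta> by (metis eventually_sequentiallyI)
  have XQ0: "X Q 0 \<ge> e / of_int \<bar>Q\<bar>" if "Q \<noteq> 0" for Q
  proof (rule tendsto_lowerbound[OF lim])
    show "\<forall>\<^sub>F n in sequentially. e / of_int \<bar>Q\<bar> \<le> rat_padic_abs p (of_int Q * s n - of_int 0)"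
      using lo
    proof eventually_elim
      case (elim n)
      have "1 / of_int \<bar>Q\<bar> * e \<le> rat_padic_abs p (of_int Q) * rat_padic_abs p (s n)"
        using rat_padic_abs_of_int_ge[OF p that] elim e
        by (intro mult_mono) (auto simp: rat_padic_abs_nonneg)
      thus ?case by (simp add: rat_padic_abs_mult[OF p])
    qed
  qed simp
  have X0R: "X 0 R \<ge> 1 / of_int \<bar>R\<bar>" if "R \<noteq> 0" for R
    using LIMSEQ_unique[OF lim[of 0 R], of "rat_padic_abs p (of_int R)"] rat_padic_abs_of_int_ge[OF p that]
    by simp
  have small: "\<exists>q r. q * r \<noteq> 0 \<and> M q r * \<bar>of_int q * \<alpha> - of_int r\<bar> * X q r < y" if y: "y > 0" for y
  proof -
    \<comment> \<open>This makes \<open>ln M\<close> exceed \<open>C^2 / y + 1\<close>, which pushes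
      the product below \<open>y\<close>, and makes \<open>M\<close> exceed \<open>C\<close> and
      \<open>C / e\<close>.\<close>
    obtain N :: nat where N: "max (exp (C\<^sup>2 / y + 1)) (C + C / e) < real N" using reals_Archimedean2 by blast
    obtain Q R where QR: "int N \<le> max \<bar>Q\<bar> \<bar>R\<bar>" "(M Q R)\<^sup>2 * X Q R \<le> C"
      "M Q R * ln (M Q R) * \<bar>of_int Q * \<alpha> - of_int R\<bar> * X Q R \<le> C\<^sup>2" using approx by blast
    have NM: "real N \<le> M Q R" using QR(1) unfolding M_def by linarith
    have ce: "C / e > 0" using C e by simp
    have big: "exp (C\<^sup>2 / y + 1) < M Q R" "C < M Q R" "C / e < M Q R"
      using N NM ce C by auto
    have M0: "M Q R > 0" using big C by linarith
    \<comment> \<open>With a zero entry the p-adic value is at least \<open>1 / M\<close> or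
      \<open>e / M\<close>, so \<open>M^2\<close> times it is at least \<open>M\<close> or
      \<open>e * M\<close> and exceeds \<open>C\<close>.\<close>
    have "Q \<noteq> 0"
    proof
      assume [simp]: "Q = 0"
      have MR: "M Q R = of_int \<bar>R\<bar>" by (simp add: M_def)
      hence "R \<noteq> 0" using M0 by auto
      hence "(M Q R)\<^sup>2 * (1 / M Q R) \<le> (M Q R)\<^sup>2 * X Q R"
        using X0R unfolding MR by (intro mult_left_mono) auto
      moreover have "(M Q R)\<^sup>2 * (1 / M Q R) = M Q R" using M0 by (simp add: power2_eq_square)
      ultimately have "M Q R \<le> C" using QR(2) by linarith
      thus False using big by simp
    qed
    moreover have "R \<noteq> 0"
    proof
      assume [simp]: "R = 0"
      have MQ: "M Q R = of_int \<bar>Q\<bar>" by (simp add: M_def)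
      hence "(M Q R)\<^sup>2 * (e / M Q R) \<le> (M Q R)\<^sup>2 * X Q R"
        using XQ0 \<open>Q \<noteq> 0\<close> unfolding MQ by (intro mult_left_mono) auto
      moreover have "(M Q R)\<^sup>2 * (e / M Q R) = M Q R * e" using M0 by (simp add: power2_eq_square)
      ultimately have "M Q R * e \<le> C" using QR(2) by linarith
      thus False using big e by (simp add: field_simps)
    qed
    moreover have "M Q R * \<bar>of_int Q * \<alpha> - of_int R\<bar> * X Q R < y"
    proof -
      have ln: "C\<^sup>2 / y + 1 < ln (M Q R)" using big(1) M0 by (metis exp_less_cancel_iff exp_ln)
      have cy: "C\<^sup>2 / y \<ge> 0" using y by simp
      have "ln (M Q R) * (M Q R * \<bar>of_int Q * \<alpha> - of_int R\<bar> * X Q R) \<le> C\<^sup>2"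
        using QR(3) by (simp add: mult_ac)
      also have "C\<^sup>2 < ln (M Q R) * y" using ln y by (simp add: field_simps)
      finally show ?thesis using ln cy by (subst (asm) mult_less_cancel_left_pos) linarith+
    qed
    ultimately show ?thesis by auto
  qed
  have first: "(INF (q, r) \<in> {(q :: int, r :: int). q * r \<noteq> 0}.
      M q r * \<bar>of_int q * \<alpha> - of_int r\<bar> * X q r) = 0" (is "Inf (?F ` ?A) = 0")
  proof (rule cInf_eq_non_empty)
    have "(1, 1) \<in> ?A" by simp
    thus "?F ` ?A \<noteq> {}" by blast
    show "0 \<le> v" if "v \<in> ?F ` ?A" for v using that X0 by (auto simp: M_def)
    show "v \<le> 0" if v: "\<And>x. x \<in> ?F ` ?A \<Longrightarrow> v \<le> x" for v
    proof (rule ccontr)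
      assume "\<not> v \<le> 0"
      then obtain q r where qr: "q * r \<noteq> 0" "M q r * \<bar>of_int q * \<alpha> - of_int r\<bar> * X q r < v"
        using small[of v] by auto
      have "v \<le> ?F (q, r)" using qr by (intro v imageI) simp
      thus False using qr by simp
    qed
  qed
  show ?thesis using first second unfolding M_def X_def by blast
qed

end
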